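(* Let $k\ge2$ be a natural number, $p$ an integer with $\gcd(|p|,k)=1$, and let $$G(z)= e^{Az^k+A_0z^{-k}}\, z^{p}\,\frac{\prod_{\nu>0} \left(1+\frac{z^k}{a_\nu}\right)}{\prod_{\mu>0} \left(1-\frac{z^k}{b_\mu}\right)}\cdot\frac{\prod_{\nu>0} \left(1+\frac{z^{-k}}{c_\nu}\right)}{\prod_{\mu>0} \left(1-\frac{z^{-k}}{d_\mu}\right)},\qquad G(z)\not\equiv z^p,$$ where $A,A_0\ge0$ and $a_\nu,b_\mu,c_\nu,d_\mu>0$ for all $\nu,\mu$. Let $\alpha\in\mathbb{C}$ with $\Im\alpha^k\ne0$. Then every $\alpha$-point $z_i$ of $G$ is simple, satisfies $\Im z_i^k\ne0$ and is distinct in absolute value from the other $\alpha$-points of $G$ (i.e. $G(z)=\alpha$ and $|z|=|z_i|$ imply $z=z_i$). If $z_i,z_{i+1}$ are two consecutive $\alpha$-points, then the inclusions $\alpha\in Q_{2q-\varkappa}$ and $z_i\in Q_{2m-\sigma}$ with $q,m\in\mathbb{Z}$ and $\varkappa,\sigma\in\{0,1\}$ imply that $z_{i+1}\in Q_{2l-1+\sigma}$, where $l$ is an integer solution of $p(l+m)\equiv 2q+1-\varkappa-\sigma\pmod{k}$.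
   Context: $e_m:=\exp\left(i\frac{m}{k}\pi\right)$ and, for $s\in\mathbb{Z}$, $Q_s:=\{z\in\mathbb{C}\setminus\{0\}:0<\operatorname{Arg}(ze_{-s})<\frac{\pi}{k}\}$, where $\operatorname{Arg}$ is the principal argument; so $Q_{s+2k}=Q_s$. The products are finite, infinite or empty and absolutely convergent. An $\alpha$-point of $G$ is a point $z$ with $G(z)=\alpha$; it is simple if $G'(z)\ne0$. The $\alpha$-points are indexed by increasing absolute value, $\cdots<|z_i|<|z_{i+1}|<\cdots$; "consecutive" means that there are no $\alpha$-points with absolute value strictly between. *)

theory Defs
  imports "HOL-Analysis.Analysis" "HOL-Number_Theory.Cong"
begin

text \<open>A finite, infinite or empty product is indexed by an arbitrary set \<open>I\<close> of natural numbers;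
  indices outside \<open>I\<close> contribute the factor 1, so that the library's notions for infinite products
  apply.  The value \<^const>\<open>prodinf\<close> of a convergent product may be 0.\<close>

definition factor_on :: "nat set \<Rightarrow> (nat \<Rightarrow> complex) \<Rightarrow> nat \<Rightarrow> complex" where
  "factor_on I f = (\<lambda>\<nu>. if \<nu> \<in> I then f \<nu> else 1)"

definition prod_on :: "nat set \<Rightarrow> (nat \<Rightarrow> complex) \<Rightarrow> complex" where
  "prod_on I f = prodinf (factor_on I f)"

definition abs_convergent_on :: "nat set \<Rightarrow> (nat \<Rightarrow> complex) \<Rightarrow> bool" where
  "abs_convergent_on I f \<longleftrightarrow> abs_convergent_prod (factor_on I f)"

definition G_fun ::
  "nat \<Rightarrow> int \<Rightarrow> real \<Rightarrow> real \<Rightarrow> nat set \<Rightarrow> (nat \<Rightarrow> real) \<Rightarrow> nat set \<Rightarrow> (nat \<Rightarrow> real) \<Rightarrow>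
   nat set \<Rightarrow> (nat \<Rightarrow> real) \<Rightarrow> nat set \<Rightarrow> (nat \<Rightarrow> real) \<Rightarrow> complex \<Rightarrow> complex" where
  "G_fun k p A A\<^sub>0 Na a Nb b Nc c Nd d z =
     exp (of_real A * z ^ k + of_real A\<^sub>0 * z powi (- int k)) * z powi p
     * (prod_on Na (\<lambda>\<nu>. 1 + z ^ k / of_real (a \<nu>))
        / prod_on Nb (\<lambda>\<mu>. 1 - z ^ k / of_real (b \<mu>)))
     * (prod_on Nc (\<lambda>\<nu>. 1 + z powi (- int k) / of_real (c \<nu>))
        / prod_on Nd (\<lambda>\<mu>. 1 - z powi (- int k) / of_real (d \<mu>)))"

text \<open>\<open>G_fun\<close> is meromorphic on the punctured plane.  For positive parameters the numerator factors
  vanish only where \<open>z ^ k\<close> is negative and the denominator factors only where \<open>z ^ k\<close> is positive,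
  so nothing cancels and the poles are exactly the zeros of the denominator factors.  They are
  removed from the domain because HOL division gives \<open>G_fun\<close> the value 0 there.\<close>

definition G_dom :: "nat \<Rightarrow> nat set \<Rightarrow> (nat \<Rightarrow> real) \<Rightarrow> nat set \<Rightarrow> (nat \<Rightarrow> real) \<Rightarrow> complex set" where
  "G_dom k Nb b Nd d =
     {z. z \<noteq> 0 \<and> (\<forall>\<mu>\<in>Nb. 1 - z ^ k / of_real (b \<mu>) \<noteq> 0)
               \<and> (\<forall>\<mu>\<in>Nd. 1 - z powi (- int k) / of_real (d \<mu>) \<noteq> 0)}"

definition points_of :: "(complex \<Rightarrow> complex) \<Rightarrow> complex set \<Rightarrow> complex \<Rightarrow> complex set" where
  "points_of G D \<alpha> = {z \<in> D. G z = \<alpha>}"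

definition simple_point :: "(complex \<Rightarrow> complex) \<Rightarrow> complex \<Rightarrow> bool" where
  "simple_point G z \<longleftrightarrow> deriv G z \<noteq> 0"

definition consecutive_in :: "complex set \<Rightarrow> complex \<Rightarrow> complex \<Rightarrow> bool" where
  "consecutive_in S z w \<longleftrightarrow>
     z \<in> S \<and> w \<in> S \<and> norm z < norm w \<and> \<not> (\<exists>u\<in>S. norm z < norm u \<and> norm u < norm w)"

definition e_rot :: "nat \<Rightarrow> int \<Rightarrow> complex" where
  "e_rot k m = exp (\<i> * (of_int m / of_nat k) * of_real pi)"

definition Q_sector :: "nat \<Rightarrow> int \<Rightarrow> complex set" where
  "Q_sector k s = {z. z \<noteq> 0 \<and> 0 < Arg (z * e_rot k (- s)) \<and> Arg (z * e_rot k (- s)) < pi / real k}"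

end

theory Submission
  imports Defs "HOL-Complex_Analysis.Complex_Analysis"
begin

text \<open>
  Write \<open>G z = z\<^sup>p F (z\<^sup>k)\<close> with \<open>F = N / M\<close>.  Every factor of \<open>F\<close> contributes a nonnegative amount to
  \<open>Im (\<zeta> F' \<zeta> / F \<zeta>)\<close> in the upper half plane, so in the variable \<open>w\<close> with \<open>z = exp w\<close> a branch \<open>K\<close> of
  \<open>log G\<close> on the strip \<open>0 < Im w < \<pi> / k\<close> has \<open>Im K' > 0\<close>.  Hence \<open>\<bar>G\<bar>\<close> strictly decreases in the
  angle, which leaves on each circle only a point \<open>X\<close> of the sector, the reflection of \<open>X\<close>, and their rotations by
  multiples of \<open>2 \<pi> / k\<close> as candidates for an \<open>\<alpha>\<close>-point; as \<open>\<alpha>\<^sup>k\<close> is not real, at most one of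
  them is one.  Along the level curve \<open>\<bar>G\<bar> = \<bar>\<alpha>\<bar>\<close>, continued along the boundary of the
  sector where the curve leaves it, a continuous argument \<open>\<Psi>\<close> of \<open>G\<close> is nondecreasing in the radius,
  and it strictly increases unless \<open>\<Psi> \<in> (\<pi> / k) \<int>\<close>.  The \<open>\<alpha>\<close>-points are the points where
  \<open>\<Psi>\<close> meets \<open>\<plusminus> Arg \<alpha> + (2 \<pi> / k) \<int>\<close>, and by the intermediate value theorem consecutive ones
  belong to neighbouring values of this set, which alternate in sign.
\<close>

section \<open>Products with negative zeros\<close>

text \<open>The weights \<open>t n\<close> are reciprocals of the parameters. A weight 0 yields the
  factor 1, so finite, infinite and empty products are treated alike, and absolute convergence
  amounts to summability of \<open>t\<close>.\<close>

definition lin_prod :: "(nat \<Rightarrow> real) \<Rightarrow> complex \<Rightarrow> complex" where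
  "lin_prod t z = prodinf (\<lambda>n. 1 + of_real (t n) * z)"

context
  fixes t :: "nat \<Rightarrow> real"
  assumes t_nonneg: "t n \<ge> 0" and t_summable: "summable t"
begin

lemma lin_prod_has_prod: "(\<lambda>n. 1 + of_real (t n) * z) has_prod lin_prod t z"
proof -
  have "summable (\<lambda>i. norm ((1 + of_real (t i) * z) - 1))"
    using t_summable t_nonneg by (auto simp: norm_mult intro!: summable_mult2[of t])
  hence "convergent_prod (\<lambda>n. 1 + of_real (t n) * z)"
    using abs_convergent_prod_conv_summable abs_convergent_prod_imp_convergent_prod by blast
  thus ?thesis unfolding lin_prod_def by (rule convergent_prod_has_prod)
qed

lemma lin_prod_eq_0_iff: "lin_prod t z = 0 \<longleftrightarrow> (\<exists>n. 1 + of_real (t n) * z = 0)"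
  using has_prod_eq_0_iff[OF lin_prod_has_prod[of z]] by (auto simp: image_iff eq_commute[of 0])

lemma lin_prod_0D:
  assumes "lin_prod t z = 0"
  shows "Im z = 0" "Re z < 0"
proof -
  obtain n where n: "1 + of_real (t n) * z = 0"
    using assms lin_prod_eq_0_iff by blast
  hence *: "1 + t n * Re z = 0" "t n * Im z = 0" by (simp_all add: complex_eq_iff)
  hence "t n \<noteq> 0" by auto
  with t_nonneg[of n] have "t n > 0" by linarith
  thus "Im z = 0" using * by simp
  show "Re z < 0"
    using * \<open>t n > 0\<close> mult_nonneg_nonneg[of "t n" "Re z"] by linarith
qed

lemma lin_prod_tendsto: "(\<lambda>N. \<Prod>n<N. 1 + of_real (t n) * z) \<longlonglongrightarrow> lin_prod t z"
  using has_prod_imp_tendsto'[OF lin_prod_has_prod] by simp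

lemma lin_prod_cnj: "lin_prod t (cnj z) = cnj (lin_prod t z)"
proof -
  have "(\<lambda>N. cnj (\<Prod>n<N. 1 + of_real (t n) * z)) \<longlonglongrightarrow> cnj (lin_prod t z)"
    by (intro tendsto_intros lin_prod_tendsto)
  moreover have "(\<lambda>N. cnj (\<Prod>n<N. 1 + of_real (t n) * z)) = (\<lambda>N. \<Prod>n<N. 1 + of_real (t n) * cnj z)"
    by (simp add: cnj_prod)
  ultimately show ?thesis using lin_prod_tendsto LIMSEQ_unique[OF lin_prod_tendsto[of "cnj z"]] by auto
qed

lemma lin_prod_uniform_limit:
  "uniform_limit (cball 0 R) (\<lambda>N z. \<Prod>n<N. 1 + of_real (t n) * z) (lin_prod t) sequentially"
proof -
  have "uniformly_convergent_on (cball 0 R) (\<lambda>N z. \<Prod>n<N. 1 + of_real (t n) * z :: complex)"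
  proof (rule uniformly_convergent_on_prod)
    show "uniformly_convergent_on (cball 0 R) (\<lambda>N z. \<Sum>n<N. norm (of_real (t n) * z :: complex))"
      by (rule Weierstrass_m_test'_ev[where M="\<lambda>n. t n * R"])
        (use t_nonneg t_summable in
          \<open>auto simp: norm_mult intro!: always_eventually mult_left_mono summable_mult2[of t]\<close>)
  qed (auto intro!: continuous_intros)
  then obtain l where l: "uniform_limit (cball 0 R)
      (\<lambda>N z. \<Prod>n<N. 1 + of_real (t n) * z :: complex) l sequentially"
    unfolding uniformly_convergent_on_def by blast
  moreover have "l z = lin_prod t z" if "z \<in> cball 0 R" for z
    using tendsto_uniform_limitI[OF l that] lin_prod_tendsto LIMSEQ_unique by blast
  ultimately show ?thesis by (auto simp: uniform_limit_iff)
qed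

lemma lin_prod_holomorphic: "lin_prod t holomorphic_on UNIV"
proof (rule holomorphic_uniform_sequence)
  show "(\<lambda>z. \<Prod>n<N. 1 + of_real (t n) * z :: complex) holomorphic_on UNIV" for N
    by (intro holomorphic_intros)
  show "\<exists>d>0. cball z d \<subseteq> UNIV \<and> uniform_limit (cball z d)
      (\<lambda>N z. \<Prod>n<N. 1 + of_real (t n) * z) (lin_prod t) sequentially" for z
  proof (intro exI conjI)
    have "cball z 1 \<subseteq> cball 0 (norm z + 1)"
      by (simp add: cball_subset_cball_iff dist_norm)
    thus "uniform_limit (cball z 1) (\<lambda>N z. \<Prod>n<N. 1 + of_real (t n) * z) (lin_prod t) sequentially"
      using lin_prod_uniform_limit uniform_limit_on_subset by blast
  qed auto
qed simp

section \<open>Logarithmic derivatives and the sign of their imaginary parts\<close>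

lemma lin_prod_logderiv_sums:
  assumes "lin_prod t z \<noteq> 0"
  shows "(\<lambda>n. of_real (t n) / (1 + of_real (t n) * z)) sums (deriv (lin_prod t) z / lin_prod t z)"
proof -
  have "(\<lambda>n. deriv (\<lambda>z. 1 + of_real (t n) * z) z / (1 + of_real (t n) * z))
      sums (deriv (lin_prod t) z / lin_prod t z)"
  proof (rule logderiv_prodinf_complex_uniform_limit)
    show "uniform_limit (ball 0 (norm z + 1)) (\<lambda>N z. \<Prod>n<N. 1 + of_real (t n) * z)
        (lin_prod t) sequentially"
      using lin_prod_uniform_limit ball_subset_cball uniform_limit_on_subset by blast
  qed (use assms in \<open>auto intro!: holomorphic_intros\<close>)
  moreover have "deriv (\<lambda>z. 1 + of_real (t n) * z) z = of_real (t n)" for n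
    by (rule DERIV_imp_deriv) (auto intro!: derivative_eq_intros)
  ultimately show ?thesis by simp
qed

text \<open>With the extra factor \<open>Im z\<close> the sign no longer depends on the half plane.
  This serves the arguments \<open>- \<zeta>\<close> and \<open>1 / \<zeta>\<close> later, which lie
  in the half plane opposite to that of \<zeta>.\<close>

lemma Im_lin_factor: "Im (z * (of_real a / (1 + of_real a * z))) * Im z
    = a * (Im z)\<^sup>2 / (norm (1 + of_real a * z))\<^sup>2"
proof -
  have "Im (z * (of_real a / (1 + of_real a * z))) = Im (of_real a * z / (1 + of_real a * z))"
    by (simp add: mult.commute)
  also have "\<dots> = a * Im z / (norm (1 + of_real a * z))\<^sup>2"
    unfolding Im_divide cmod_power2 by (simp add: algebra_simps)
  finally show ?thesis by (simp add: power2_eq_square)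
qed

lemma lin_prod_logderiv_Im_sums:
  assumes "lin_prod t z \<noteq> 0"
  shows "(\<lambda>n. t n * (Im z)\<^sup>2 / (norm (1 + of_real (t n) * z))\<^sup>2)
    sums (Im (z * (deriv (lin_prod t) z / lin_prod t z)) * Im z)"
proof -
  have "(\<lambda>n. Im (z * (of_real (t n) / (1 + of_real (t n) * z))) * Im z)
    sums (Im (z * (deriv (lin_prod t) z / lin_prod t z)) * Im z)"
    by (intro sums_mult2 sums_Im sums_mult lin_prod_logderiv_sums assms)
  thus ?thesis by (simp only: Im_lin_factor)
qed

lemma lin_prod_logderiv_nonneg:
  assumes "Im z \<noteq> 0"
  shows "0 \<le> Im (z * (deriv (lin_prod t) z / lin_prod t z)) * Im z"
proof -
  have "lin_prod t z \<noteq> 0" using assms lin_prod_0D by blast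
  from sums_le[OF _ sums_zero lin_prod_logderiv_Im_sums[OF this]] show ?thesis
    using t_nonneg by simp
qed

lemma lin_prod_logderiv_pos:
  assumes "Im z \<noteq> 0" and "t j \<noteq> 0"
  shows "0 < Im (z * (deriv (lin_prod t) z / lin_prod t z)) * Im z"
proof -
  let ?f = "\<lambda>n. t n * (Im z)\<^sup>2 / (norm (1 + of_real (t n) * z))\<^sup>2"
  have nz: "lin_prod t z \<noteq> 0" using assms lin_prod_0D by blast
  hence "1 + of_real (t j) * z \<noteq> 0" using lin_prod_eq_0_iff by blast
  moreover have "t j > 0" using t_nonneg[of j] assms by linarith
  ultimately have "0 < ?f j" using assms by simp
  hence "0 < suminf ?f"
    using lin_prod_logderiv_Im_sums[OF nz] t_nonneg by (intro suminf_pos2[of _ j]) (auto simp: sums_iff)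
  thus ?thesis using lin_prod_logderiv_Im_sums[OF nz] by (simp add: sums_iff)
qed

end

section \<open>The logarithm on the sector\<close>

text \<open>\<open>N\<close> and \<open>M\<close> are the numerator and denominator of
  \<open>F\<close> as functions of \<zeta> = \<open>z ^ k\<close>. They are kept apart because
  division hides the poles, whereas \<open>N\<close> and \<open>M\<close> are continuous there. The
  factor \<open>Im \<zeta>\<close> in \<open>logderiv_Im\<close> covers both half planes.\<close>

locale angular_quotient =
  fixes k :: nat and p :: int and N M :: "complex \<Rightarrow> complex"
  assumes k_ge_2: "k \<ge> 2" and p_coprime: "coprime p (int k)"
    and N_holomorphic: "N holomorphic_on - {0}" and M_holomorphic: "M holomorphic_on - {0}"
    and N_cnj: "N (cnj \<zeta>) = cnj (N \<zeta>)" and M_cnj: "M (cnj \<zeta>) = cnj (M \<zeta>)"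
    and N_0D: "\<zeta> \<noteq> 0 \<Longrightarrow> N \<zeta> = 0 \<Longrightarrow> Im \<zeta> = 0 \<and> Re \<zeta> < 0"
    and M_0D: "\<zeta> \<noteq> 0 \<Longrightarrow> M \<zeta> = 0 \<Longrightarrow> Im \<zeta> = 0 \<and> Re \<zeta> > 0"
    and logderiv_Im: "Im \<zeta> \<noteq> 0 \<Longrightarrow>
      0 < Im (\<zeta> * (deriv N \<zeta> / N \<zeta> - deriv M \<zeta> / M \<zeta>)) * Im \<zeta>"
begin

definition g :: "complex \<Rightarrow> complex" where
  "g z = z powi p * (N (z ^ k) / M (z ^ k))"

text \<open>In the coordinate \<open>w\<close> with \<open>z = exp w\<close>,
  \<open>\<rho> w\<close> is \<open>z ^ k\<close> and \<open>H w\<close> is \<open>g z\<close>. As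
  \<open>Re w\<close> is the logarithm of the radius and \<open>Im w\<close> the angle,
  \<open>strip\<close> stands for \<open>Q_sector k 0\<close>.\<close>

definition \<rho> :: "complex \<Rightarrow> complex" where
  "\<rho> w = exp (of_nat k * w)"

definition H :: "complex \<Rightarrow> complex" where
  "H w = exp (of_int p * w) * (N (\<rho> w) / M (\<rho> w))"

definition strip :: "complex set" where
  "strip = {w. 0 < Im w \<and> Im w < pi / k}"

definition logderiv_H :: "complex \<Rightarrow> complex" where
  "logderiv_H w = of_int p + of_nat k * (\<rho> w * (deriv N (\<rho> w) / N (\<rho> w) - deriv M (\<rho> w) / M (\<rho> w)))"

lemma k_pos: "0 < k" "0 < real k"
  using k_ge_2 by auto

lemma \<rho>_nonzero [simp]: "\<rho> w \<noteq> 0"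
  by (simp add: \<rho>_def)

lemma \<rho>_eq: "\<rho> w = exp w ^ k"
  by (simp add: \<rho>_def exp_of_nat_mult)

lemma Im_\<rho>: "Im (\<rho> w) = exp (k * Re w) * sin (k * Im w)"
  by (simp add: \<rho>_def Im_exp)

lemma g_exp: "g (exp w) = H w"
  by (simp add: g_def H_def \<rho>_eq exp_power_int)

lemma strip_Im_\<rho>: "w \<in> strip \<Longrightarrow> 0 < Im (\<rho> w)"
  unfolding Im_\<rho> strip_def using k_pos
  by (intro mult_pos_pos sin_gt_zero) (auto simp: field_simps)

lemma N_M_nonzero:
  assumes "Im \<zeta> \<noteq> 0"
  shows "N \<zeta> \<noteq> 0" "M \<zeta> \<noteq> 0"
  using N_0D[of \<zeta>] M_0D[of \<zeta>] assms by force+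

lemma strip_nonzero:
  assumes "w \<in> strip"
  shows "N (\<rho> w) \<noteq> 0" "M (\<rho> w) \<noteq> 0" "H w \<noteq> 0"
  using N_M_nonzero[of "\<rho> w"] strip_Im_\<rho>[OF assms] by (auto simp: H_def)

lemma open_strip: "open strip"
  unfolding strip_def by (intro open_Collect_conj open_halfspace_Im_gt open_halfspace_Im_lt)

lemma convex_strip: "convex strip"
proof -
  have "strip = {w. Im w > 0} \<inter> {w. Im w < pi / k}" by (auto simp: strip_def)
  thus ?thesis by (simp add: convex_Int convex_halfspace_Im_gt convex_halfspace_Im_lt)
qed

lemma \<rho>_DERIV: "(\<rho> has_field_derivative of_nat k * \<rho> w) (at w)"
  unfolding \<rho>_def by (auto intro!: derivative_eq_intros)

lemma comp_\<rho>_DERIV: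
  assumes "f holomorphic_on - {0}"
  shows "((\<lambda>w. f (\<rho> w)) has_field_derivative deriv f (\<rho> w) * (of_nat k * \<rho> w)) (at w)"
  by (rule DERIV_chain2[OF holomorphic_derivI[OF assms] \<rho>_DERIV]) auto

lemma H_DERIV:
  assumes "N (\<rho> w) \<noteq> 0" "M (\<rho> w) \<noteq> 0"
  shows "(H has_field_derivative H w * logderiv_H w) (at w)"
  unfolding H_def
  by (rule derivative_eq_intros comp_\<rho>_DERIV N_holomorphic M_holomorphic refl assms)+
     (use assms in \<open>simp add: logderiv_H_def field_simps power2_eq_square\<close>)

text \<open>The power \<open>z powi p\<close> contributes only the real number \<open>p\<close>, so
  the sign comes from \<open>N\<close> and \<open>M\<close> alone.\<close>

lemma logderiv_H_pos:
  assumes "w \<in> strip"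
  shows "0 < Im (logderiv_H w)"
proof -
  have "0 < Im (\<rho> w * (deriv N (\<rho> w) / N (\<rho> w) - deriv M (\<rho> w) / M (\<rho> w)))"
    using logderiv_Im[of "\<rho> w"] strip_Im_\<rho>[OF assms] by (simp add: zero_less_mult_iff)
  moreover have "Im (of_nat k * x) = k * Im x" for x by simp
  ultimately show ?thesis using k_pos by (simp add: logderiv_H_def del: times_complex.sel)
qed

lemma ex_log_H: "\<exists>K. \<forall>w\<in>strip. H w = exp (K w) \<and> (K has_field_derivative logderiv_H w) (at w)"
proof -
  have hol: "H holomorphic_on strip"
    using H_DERIV strip_nonzero open_strip by (auto simp: holomorphic_on_open)
  obtain K where K: "K holomorphic_on strip" "\<And>w. w \<in> strip \<Longrightarrow> H w = exp (K w)"
    using contractible_imp_holomorphic_log[OF hol convex_imp_contractible[OF convex_strip]]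
      strip_nonzero by blast
  have "(K has_field_derivative logderiv_H w) (at w)" if w: "w \<in> strip" for w
  proof -
    have dK: "(K has_field_derivative deriv K w) (at w)"
      using K(1) open_strip w by (rule holomorphic_derivI)
    have "((\<lambda>w. exp (K w)) has_field_derivative exp (K w) * deriv K w) (at w)"
      by (rule DERIV_chain2[OF DERIV_exp dK])
    hence "(H has_field_derivative H w * deriv K w) (at w)"
      using K(2) open_strip w by (subst DERIV_cong_ev[OF refl eventually_nhds_in_open[THEN eventually_mono] refl])
        (auto intro!: eventually_nhds_in_open)
    hence "H w * deriv K w = H w * logderiv_H w"
      using H_DERIV strip_nonzero w DERIV_unique by blast
    thus ?thesis using dK strip_nonzero w by simp
  qed
  thus ?thesis using K by blast
qed

definition log_H :: "complex \<Rightarrow> complex" where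
  "log_H = (SOME K. \<forall>w\<in>strip. H w = exp (K w) \<and> (K has_field_derivative logderiv_H w) (at w))"

lemma log_H:
  assumes "w \<in> strip"
  shows "H w = exp (log_H w)" "(log_H has_field_derivative logderiv_H w) (at w)"
  using someI_ex[OF ex_log_H] assms unfolding log_H_def by blast+

lemma norm_H: "w \<in> strip \<Longrightarrow> norm (H w) = exp (Re (log_H w))"
  using log_H by simp

text \<open>The mean value theorem along the segment from \<open>x\<close> to \<open>y\<close>.\<close>

lemma log_H_increment:
  assumes "x \<in> strip" "y \<in> strip" "x \<noteq> y"
  shows "0 < Im ((log_H y - log_H x) * cnj (y - x))"
proof -
  let ?\<gamma> = "\<lambda>s. x + of_real s * (y - x)"
  let ?f = "\<lambda>s. Im (log_H (?\<gamma> s) * cnj (y - x))"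
  have mem: "?\<gamma> s \<in> strip" if "0 \<le> s" "s \<le> 1" for s
  proof -
    have "(1 - s) *\<^sub>R x + s *\<^sub>R y \<in> strip"
      using convex_strip assms that by (auto simp: convex_def)
    thus ?thesis by (simp add: scaleR_conv_of_real algebra_simps)
  qed
  have "?f 0 < ?f 1"
  proof (rule DERIV_pos_imp_increasing[of 0 1 ?f])
    fix s :: real assume s: "0 \<le> s" "s \<le> 1"
    have "(?\<gamma> has_vector_derivative y - x) (at s)"
      by (auto intro!: derivative_eq_intros simp: has_vector_derivative_def scaleR_conv_of_real)
    from field_vector_diff_chain_at[OF this log_H(2)[OF mem[OF s]]]
    have "((\<lambda>s. log_H (?\<gamma> s)) has_vector_derivative (y - x) * logderiv_H (?\<gamma> s)) (at s)"
      by (simp add: o_def)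
    hence d: "(?f has_vector_derivative Im ((y - x) * logderiv_H (?\<gamma> s) * cnj (y - x))) (at s)"
      by (intro bounded_linear.has_vector_derivative[OF bounded_linear_Im]
          has_vector_derivative_mult_left)
    \<comment> \<open>The factor \<open>cnj (y - x)\<close> cancels the direction of the segment and
      leaves a positive multiple of \<open>logderiv_H\<close>.\<close>
    have "(y - x) * logderiv_H (?\<gamma> s) * cnj (y - x)
        = of_real ((norm (y - x))\<^sup>2) * logderiv_H (?\<gamma> s)"
      unfolding complex_norm_square by simp
    moreover have "Im (of_real r * z) = r * Im z" for r z by simp
    ultimately have "Im ((y - x) * logderiv_H (?\<gamma> s) * cnj (y - x))
        = (norm (y - x))\<^sup>2 * Im (logderiv_H (?\<gamma> s))" by metis
    also have "\<dots> > 0" using assms logderiv_H_pos[OF mem[OF s]] by simp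
    finally show "\<exists>d. (?f has_real_derivative d) (at s) \<and> d > 0"
      using d unfolding has_real_derivative_iff_has_vector_derivative by blast
  qed simp
  thus ?thesis by (simp add: algebra_simps)
qed

text \<open>On a vertical line \<open>y - x\<close> is purely imaginary, so the increment inequality
  concerns only the real part of \<open>log_H\<close>, the logarithm of the modulus.\<close>

lemma norm_H_strict_antimono:
  assumes "x \<in> strip" "y \<in> strip" "Re x = Re y" "Im x < Im y"
  shows "norm (H y) < norm (H x)"
proof -
  have "x \<noteq> y" using assms by auto
  from log_H_increment[OF assms(1,2) this] assms
  have "0 < (Re (log_H x) - Re (log_H y)) * (Im y - Im x)"
    by (simp add: algebra_simps)
  thus ?thesis using assms by (simp add: norm_H zero_less_mult_iff)
qed

end

section \<open>Rotations and reflections\<close>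

context angular_quotient
begin
text \<open>These are the rotations that fix \<open>z ^ k\<close>; \<open>rot j\<close> equals
  \<open>e_rot k (2 * j)\<close>.\<close>

definition rot :: "int \<Rightarrow> complex" where
  "rot j = cis (2 * pi * of_int j / k)"

lemma rot_nonzero [simp]: "rot j \<noteq> 0" and norm_rot [simp]: "norm (rot j) = 1"
  by (simp_all add: rot_def)

lemma cnj_rot: "cnj (rot j) = rot (- j)"
  by (simp add: rot_def cis_cnj)

lemma rot_add: "rot (i + j) = rot i * rot j"
  by (simp add: rot_def cis_mult add_divide_distrib distrib_left)

lemma rot_power_k: "rot j ^ k = 1"
proof -
  have "rot j ^ k = cis (real k * (2 * pi * of_int j / k))" unfolding rot_def by (rule Complex.DeMoivre)
  also have "real k * (2 * pi * of_int j / k) = 2 * pi * of_int j" using k_pos by simp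
  finally show ?thesis by (simp add: cis_multiple_2pi)
qed

lemma rot_power_int: "rot j powi i = rot (i * j)"
  by (simp add: rot_def cis_power_int mult_ac)

lemma rot_eq_1_iff: "rot j = 1 \<longleftrightarrow> int k dvd j"
proof
  assume "rot j = 1"
  then obtain n where "2 * pi * of_int j / k = of_int (2 * n) * pi"
    unfolding rot_def cis_conv_exp exp_eq_1 by auto
  hence "real_of_int j = of_int (int k * n)" using k_pos by (simp add: field_simps)
  thus "int k dvd j" using of_int_eq_iff by (metis dvd_triv_left)
next
  assume "int k dvd j"
  then obtain n where "j = int k * n" by blast
  hence "2 * pi * of_int j / k = 2 * pi * of_int n" using k_pos by simp
  thus "rot j = 1" unfolding rot_def by (simp add: cis_multiple_2pi)
qed

lemma rot_eq_iff: "rot i = rot j \<longleftrightarrow> [i = j] (mod int k)"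
proof -
  have "rot i = rot (i - j) * rot j" by (simp flip: rot_add)
  hence "rot i = rot j \<longleftrightarrow> rot (i - j) = 1" by simp
  thus ?thesis by (simp add: rot_eq_1_iff cong_iff_dvd_diff)
qed

lemma g_rot: "g (rot j * z) = rot (p * j) * g z"
  by (simp add: g_def power_int_mult_distrib power_mult_distrib rot_power_k rot_power_int)

lemma g_cnj: "g (cnj z) = cnj (g z)"
  by (simp add: g_def N_cnj M_cnj complex_cnj_power_int flip: complex_cnj_power)

text \<open>At a real \<open>z ^ k\<close> both \<open>N\<close> and \<open>M\<close> are real,
  since they commute with conjugation. Then \<open>g z ^ k\<close>, which is
  \<open>(z ^ k) powi p\<close> times the \<open>k\<close>-th power of their quotient, is real
  too.\<close>

lemma Im_power_k_nonzero:
  assumes "Im (g z ^ k) \<noteq> 0"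
  shows "Im (z ^ k) \<noteq> 0"
proof
  assume "Im (z ^ k) = 0"
  hence real: "cnj (z ^ k) = z ^ k"
    by (simp add: complex_eq_iff del: complex_cnj_power)
  have "cnj (N (z ^ k)) = N (z ^ k)" "cnj (M (z ^ k)) = M (z ^ k)"
    using N_cnj[of "z ^ k"] M_cnj[of "z ^ k"] by (simp_all only: real)
  moreover have "g z ^ k = (z ^ k) powi p * (N (z ^ k) / M (z ^ k)) ^ k"
    unfolding g_def power_mult_distrib
    by (simp add: power_int_power power_int_power' mult.commute)
  moreover have "cnj (\<zeta> powi p * (x / y) ^ k) = \<zeta> powi p * (x / y) ^ k"
    if "cnj \<zeta> = \<zeta>" "cnj x = x" "cnj y = y" for \<zeta> x y
    using that by (simp add: complex_cnj_power_int)
  ultimately have "cnj (g z ^ k) = g z ^ k" using real by metis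
  thus False using assms by (simp add: complex_eq_iff del: complex_cnj_power)
qed

section \<open>Sectors as rotated and reflected copies of the strip\<close>

lemma mem_Q_sector_iff: "z \<in> Q_sector k s \<longleftrightarrow> (\<exists>x\<in>strip. z = cis (pi * of_int s / k) * exp x)"
proof
  have e: "e_rot k (- s) = cis (- (pi * of_int s / k))" unfolding e_rot_def cis_conv_exp by (simp add: mult_ac)
  have nz: "e_rot k (- s) \<noteq> 0" by (simp add: e)
  {
    assume z: "z \<in> Q_sector k s"
    define x where "x = Ln (z * e_rot k (- s))"
    have "z * e_rot k (- s) \<noteq> 0" using z nz by (auto simp: Q_sector_def)
    hence "exp x = z * e_rot k (- s)" "Im x = Arg (z * e_rot k (- s))"
      unfolding x_def by (simp_all add: Arg_eq_Im_Ln)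
    hence "x \<in> strip" "z = cis (pi * of_int s / k) * exp x"
      using z by (auto simp: Q_sector_def strip_def e cis_mult)
    thus "\<exists>x\<in>strip. z = cis (pi * of_int s / k) * exp x" by blast
  }
  assume "\<exists>x\<in>strip. z = cis (pi * of_int s / k) * exp x"
  then obtain x where x: "x \<in> strip" "z = cis (pi * of_int s / k) * exp x" by blast
  have ze: "z * e_rot k (- s) = exp x" using x by (simp add: e cis_mult)
 \<comment> \<open>The angle \<open>Im x\<close> thus lies in the range of the principal
   argument.\<close>
 have "pi / k \<le> pi" using k_pos by (simp add: field_simps)
  hence "Arg (exp x) = Im x" using x(1) by (intro Arg_exp) (auto simp: strip_def)
  thus "z \<in> Q_sector k s" unfolding Q_sector_def mem_Collect_eq ze using x by (auto simp: strip_def)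
qed

lemma mem_Q_sector_even_iff: "z \<in> Q_sector k (2 * j) \<longleftrightarrow> (\<exists>x\<in>strip. z = rot j * exp x)"
  unfolding mem_Q_sector_iff by (simp add: rot_def mult_ac)

text \<open>Conjugation turns the angles between \<open>s * pi / k\<close> and
  \<open>(s + 1) * pi / k\<close> into those between \<open>- (s + 1) * pi / k\<close> and
  \<open>- s * pi / k\<close>, whence the index \<open>- 1 - s\<close>.\<close>

lemma cnj_mem_Q_sector:
  assumes "z \<in> Q_sector k s" "s + s' = - 1"
  shows "cnj z \<in> Q_sector k s'"
proof -
  obtain x where x: "x \<in> strip" "z = cis (pi * of_int s / k) * exp x"
    using assms mem_Q_sector_iff by blast
  have s: "s = - 1 - s'" using assms by simp
  \<comment> \<open>The mirror image of \<open>x\<close> in the midline of the strip.\<close>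
  let ?y = "cnj x + \<i> * of_real (pi / k)"
  have "- (pi * of_int s / k) = pi * of_int s' / k + pi / k"
    using k_pos by (simp add: s field_simps)
  hence "cnj (cis (pi * of_int s / k)) = cis (pi * of_int s' / k) * cis (pi / k)"
    by (simp only: cis_cnj cis_mult)
  moreover have "exp ?y = cis (pi / k) * cnj (exp x)"
    by (simp add: exp_add exp_cnj cis_conv_exp mult.commute)
  ultimately have "cnj z = cis (pi * of_int s' / k) * exp ?y" by (simp add: x)
  moreover have "?y \<in> strip" using x k_pos by (simp add: strip_def)
  ultimately show ?thesis unfolding mem_Q_sector_iff by blast
qed

lemma rot_cnj_mem_Q_sector:
  assumes "x \<in> strip"
  shows "rot j * cnj (exp x) \<in> Q_sector k (2 * j - 1)"
proof -
  have "cnj (rot j * cnj (exp x)) \<in> Q_sector k (2 * - j)"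
    unfolding mem_Q_sector_even_iff using assms by (auto simp: cnj_rot)
  from cnj_mem_Q_sector[OF this] show ?thesis by simp
qed

text \<open>The integer part of \<open>Arg z * k / pi\<close> numbers the sector of
  \<open>z\<close>. Even sectors are rotations of the image of the strip, odd ones of its
  reflection; a non-real \<open>z ^ k\<close> keeps \<open>z\<close> off the boundary rays.\<close>

lemma strip_representation:
  assumes "Im (z ^ k) \<noteq> 0"
  obtains x j where "x \<in> strip" "Re x = ln (norm z)" "z = rot j * exp x"
  | x j where "x \<in> strip" "Re x = ln (norm z)" "z = rot j * cnj (exp x)"
proof -
  have z: "z \<noteq> 0" using assms k_pos by auto
  define n \<phi> where "n = \<lfloor>Arg z * k / pi\<rfloor>" and "\<phi> = Arg z - n * pi / k"
  have Arg: "Arg z = n * pi / k + \<phi>" by (simp add: \<phi>_def)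
  have polar: "z = of_real (norm z) * cis (n * pi / k + \<phi>)"
    using rcis_cmod_Arg[of z] by (simp add: rcis_def flip: Arg)
  have exp_ln: "exp (of_real (ln (norm z)) + \<i> * of_real y) = of_real (norm z) * cis y" for y
    using z by (simp add: exp_add cis_conv_exp exp_of_real)
  have n: "n \<le> Arg z * k / pi" "Arg z * k / pi < n + 1"
    unfolding n_def by linarith+
  hence "n * pi / k \<le> Arg z" "Arg z < n * pi / k + pi / k"
    using k_pos by (simp_all add: field_simps)
  hence "0 \<le> \<phi>" "\<phi> < pi / k"
    by (auto simp: \<phi>_def)
  moreover have "\<phi> \<noteq> 0"
  proof
    assume "\<phi> = 0"
    hence "z ^ k = of_real (norm z ^ k) * cis (n * pi)"
      using k_pos by (subst polar) (simp add: power_mult_distrib Complex.DeMoivre)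
    thus False using assms by (simp add: sin_integer_2pi sin_int_times_real mult.commute)
  qed
  ultimately have \<phi>: "0 < \<phi>" "\<phi> < pi / k" by auto
  show ?thesis
  proof (cases "even n")
    case True
    then obtain j where j: "n = 2 * j" by blast
    let ?x = "of_real (ln (norm z)) + \<i> * of_real \<phi>"
    have "rot j * exp ?x = of_real (norm z) * cis (n * pi / k + \<phi>)"
      unfolding exp_ln by (simp add: rot_def cis_mult j algebra_simps)
    moreover have "?x \<in> strip" using \<phi> by (simp add: strip_def)
    ultimately show ?thesis using polar that(1)[of ?x j] by simp
  next
    case False
    hence "even (n + 1)" by simp
    then obtain j where "n + 1 = 2 * j" by blast
    hence j: "n = 2 * j - 1" by simp
    \<comment> \<open>In an odd sector the angle is measured backwards from the upper edge, which
      has direction \<open>rot j\<close>.\<close>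
    let ?x = "of_real (ln (norm z)) + \<i> * of_real (pi / k - \<phi>)"
    have "rot j * cnj (exp ?x) = of_real (norm z) * (rot j * cis (- (pi / k - \<phi>)))"
      unfolding exp_ln by (simp add: cis_cnj)
    also have "rot j * cis (- (pi / k - \<phi>)) = cis (n * pi / k + \<phi>)"
      using k_pos by (simp add: rot_def cis_mult j field_simps)
    finally have "rot j * cnj (exp ?x) = of_real (norm z) * cis (n * pi / k + \<phi>)" .
    moreover have "?x \<in> strip" using \<phi> by (simp add: strip_def)
    ultimately show ?thesis using polar that(2)[of ?x j] by simp
  qed
qed

section \<open>Uniqueness on circles and simplicity\<close>

lemma g_power_k_nonzero: "Im (g z ^ k) \<noteq> 0 \<Longrightarrow> z \<noteq> 0 \<and> g z \<noteq> 0"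
  using Im_power_k_nonzero[of z] k_pos by auto

lemma g_representation:
  assumes "Im (g z ^ k) \<noteq> 0"
  obtains x j where "x \<in> strip" "Re x = ln (norm z)" "norm (H x) = norm (g z)"
      "z = rot j * exp x" "g z = rot (p * j) * H x"
  | x j where "x \<in> strip" "Re x = ln (norm z)" "norm (H x) = norm (g z)"
      "z = rot j * cnj (exp x)" "g z = rot (p * j) * cnj (H x)"
proof (cases rule: strip_representation[OF Im_power_k_nonzero[OF assms]])
  case (1 x j)
  hence "g z = rot (p * j) * H x" by (simp add: g_rot g_exp)
  thus ?thesis using 1 that(1)[of x j] by (simp add: norm_mult)
next
  case (2 x j)
  hence "g z = rot (p * j) * cnj (H x)" by (simp add: g_rot g_cnj g_exp del: exp_cnj)
  thus ?thesis using 2 that(2)[of x j] by (simp add: norm_mult)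
qed

lemma strip_eqI:
  assumes "x \<in> strip" "y \<in> strip" "Re x = Re y" "norm (H x) = norm (H y)"
  shows "x = y"
  using norm_H_strict_antimono[of x y] norm_H_strict_antimono[of y x] assms
  by (metis complex_eqI less_irrefl linorder_neqE_linordered_idom)

text \<open>Both points come from strip points with equal real part and equal modulus of
  \<open>H\<close>, hence from a single one. If both are rotations of it, or both rotations of its
  reflection, they agree because \<open>p\<close> is invertible modulo \<open>k\<close>.\<close>

theorem eq_if_norm_eq:
  assumes "g z = g w" "Im (g z ^ k) \<noteq> 0" "norm z = norm w"
  shows "z = w"
proof -
  have inj: "rot i = rot j" if "rot (p * i) = rot (p * j)" for i j
    using that p_coprime by (simp add: rot_eq_iff cong_mult_lcancel)
  \<comment> \<open>A rotation and a rotated reflection cannot share their value: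
    \<open>g z ^ k\<close> would equal its conjugate.\<close>
  have mixed: False if "rot (p * i) * h = rot (p * j) * cnj h" "g z = rot (p * i) * h" for h i j
  proof -
    have "g z ^ k = h ^ k"
      unfolding that(2) by (simp add: power_mult_distrib rot_power_k)
    moreover have "g z ^ k = cnj h ^ k"
      unfolding that(2) that(1)
      by (simp add: power_mult_distrib rot_power_k del: complex_cnj_power)
    ultimately have "cnj (g z ^ k) = g z ^ k" by simp
    thus False using assms(2) by (simp add: complex_eq_iff del: complex_cnj_power)
  qed
  have w: "Im (g w ^ k) \<noteq> 0" using assms by simp
  show ?thesis
  proof (cases rule: g_representation[OF assms(2)]; cases rule: g_representation[OF w])
    fix x i y j
    assume *: "x \<in> strip" "Re x = ln (norm z)" "norm (H x) = norm (g z)" "z = rot i * exp x"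
      "g z = rot (p * i) * H x" "y \<in> strip" "Re y = ln (norm w)" "norm (H y) = norm (g w)"
      "w = rot j * exp y" "g w = rot (p * j) * H y"
    have xy: "x = y" using * assms(1,3) by (intro strip_eqI) simp_all
    have "rot (p * i) * H y = rot (p * j) * H y" using * assms(1) xy by metis
    hence "rot (p * i) = rot (p * j)" using strip_nonzero[OF *(6)] by simp
    thus "z = w" using inj[of i j] *(4,9) xy by simp
  next
    fix x i y j
    assume *: "x \<in> strip" "Re x = ln (norm z)" "norm (H x) = norm (g z)" "z = rot i * exp x"
      "g z = rot (p * i) * H x" "y \<in> strip" "Re y = ln (norm w)" "norm (H y) = norm (g w)"
      "w = rot j * cnj (exp y)" "g w = rot (p * j) * cnj (H y)"
    have xy: "x = y" using * assms(1,3) by (intro strip_eqI) simp_all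
    have "rot (p * i) * H x = rot (p * j) * cnj (H x)"
      using *(5,10) assms(1) xy by simp
    thus "z = w" using mixed *(5) by blast
  next
    fix x i y j
    assume *: "x \<in> strip" "Re x = ln (norm z)" "norm (H x) = norm (g z)" "z = rot i * cnj (exp x)"
      "g z = rot (p * i) * cnj (H x)" "y \<in> strip" "Re y = ln (norm w)" "norm (H y) = norm (g w)"
      "w = rot j * exp y" "g w = rot (p * j) * H y"
    have xy: "x = y" using * assms(1,3) by (intro strip_eqI) simp_all
    have "rot (p * i) * cnj (H x) = rot (p * j) * cnj (cnj (H x))"
      using *(5,10) assms(1) xy by simp
    thus "z = w" using mixed *(5) by blast
  next
    fix x i y j
    assume *: "x \<in> strip" "Re x = ln (norm z)" "norm (H x) = norm (g z)" "z = rot i * cnj (exp x)"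
      "g z = rot (p * i) * cnj (H x)" "y \<in> strip" "Re y = ln (norm w)" "norm (H y) = norm (g w)"
      "w = rot j * cnj (exp y)" "g w = rot (p * j) * cnj (H y)"
    have xy: "x = y" using * assms(1,3) by (intro strip_eqI) simp_all
    have "rot (p * i) * cnj (H y) = rot (p * j) * cnj (H y)" using * assms(1) xy by metis
    hence "rot (p * i) = rot (p * j)" using strip_nonzero[OF *(6)] by simp
    thus "z = w" using inj[of i j] *(4,9) xy by simp
  qed
qed

text \<open>A critical point would make \<open>logderiv_H\<close> vanish at a logarithm of
  \<open>z\<close>, but its imaginary part is nonzero over either open half plane.\<close>

theorem deriv_g_nonzero:
  assumes "Im (g z ^ k) \<noteq> 0"
  shows "deriv g z \<noteq> 0"
proof
  assume 0: "deriv g z = 0"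
  have zk: "Im (z ^ k) \<noteq> 0" and z: "z \<noteq> 0" "g z \<noteq> 0"
    using Im_power_k_nonzero[OF assms] g_power_k_nonzero[OF assms] by auto
  \<comment> \<open>A value of \<open>deriv\<close> carries information only for a differentiable
    function, so differentiability comes first.\<close>
  have comp: "(\<lambda>z. f (z ^ k)) field_differentiable at z" if "f holomorphic_on - {0}" for f
    using DERIV_chain2[OF holomorphic_derivI[OF that, of "z ^ k"] DERIV_power[OF DERIV_ident]] z
    by (auto simp: field_differentiable_def)
  have "(\<lambda>z. z powi p) field_differentiable at z"
    using z by (auto simp: field_differentiable_def intro!: exI derivative_eq_intros)
  hence "g field_differentiable at z"
    unfolding g_def using N_M_nonzero[OF zk]
    by (intro field_differentiable_mult field_differentiable_divide comp N_holomorphic M_holomorphic)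
  hence g': "(g has_field_derivative 0) (at z)" using 0 field_differentiable_derivI by fastforce
  define w where "w = Ln z"
  have w: "exp w = z" using z by (simp add: w_def)
  have "((\<lambda>w. g (exp w)) has_field_derivative 0 * exp w) (at w)"
    by (rule DERIV_chain2[OF _ DERIV_exp]) (simp add: w g')
  hence "(H has_field_derivative 0) (at w)" by (simp add: g_exp)
  moreover have \<rho>: "\<rho> w = z ^ k" by (simp add: \<rho>_eq w)
  ultimately have "H w * logderiv_H w = 0"
    using H_DERIV N_M_nonzero[OF zk] DERIV_unique by metis
  hence "logderiv_H w = 0" using z w g_exp[of w] by simp
  hence "of_nat k * (\<rho> w * (deriv N (\<rho> w) / N (\<rho> w) - deriv M (\<rho> w) / M (\<rho> w))) = - of_int p"
    unfolding logderiv_H_def by (simp add: add_eq_0_iff)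
  hence "Im (of_nat k * (\<rho> w * (deriv N (\<rho> w) / N (\<rho> w) - deriv M (\<rho> w) / M (\<rho> w)))) = 0"
    by (simp del: times_complex.sel)
  moreover have "Im (of_nat k * x) = k * Im x" for x by simp
  ultimately show False
    using logderiv_Im[OF zk] k_pos by (simp add: \<rho> del: times_complex.sel)
qed

end

section \<open>The level curve\<close>

text \<open>The zero of a decreasing function on \<open>[0, c]\<close>, moved to the nearer endpoint if there is none.\<close>

lemma monotone_level_function:
  fixes u :: "real \<Rightarrow> real \<Rightarrow> real"
  assumes c: "c > 0"
    and cont1: "\<And>\<phi>. continuous_on UNIV (\<lambda>t. u t \<phi>)"
    and cont2: "\<And>t. continuous_on UNIV (u t)"
    and decr: "\<And>t x y. 0 \<le> x \<Longrightarrow> x < y \<Longrightarrow> y \<le> c \<Longrightarrow> 0 \<le> u t y \<Longrightarrow> 0 < u t x"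
  obtains \<theta> where "continuous_on UNIV \<theta>" "\<And>t. 0 \<le> \<theta> t" "\<And>t. \<theta> t \<le> c"
    "\<And>t. \<theta> t < c \<Longrightarrow> u t (\<theta> t) \<le> 0" "\<And>t. 0 < \<theta> t \<Longrightarrow> 0 \<le> u t (\<theta> t)"
proof -
  \<comment> \<open>Inserting 0 makes the supremum 0 when \<open>u t\<close> is negative on all of
    [0, c].\<close>
  define A where "A t = insert 0 {\<phi>\<in>{0..c}. 0 \<le> u t \<phi>}" for t
  define \<theta> where "\<theta> t = Sup (A t)" for t
  have ne: "A t \<noteq> {}" and bdd: "bdd_above (A t)" for t
    using c by (auto simp: A_def intro!: bdd_aboveI[of _ c])
  have ge_0: "0 \<le> \<theta> t" for t
    unfolding \<theta>_def by (rule cSup_upper[OF _ bdd]) (simp add: A_def)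
  have le_c: "\<theta> t \<le> c" for t
    unfolding \<theta>_def by (rule cSup_least[OF ne]) (use c in \<open>auto simp: A_def\<close>)
  have pos: "0 < u t x" if x: "0 \<le> x" "x < \<theta> t" for t x
  proof -
    obtain y where "y \<in> A t" "x < y" using less_cSupE[OF _ ne, of x] x(2) unfolding \<theta>_def by blast
    thus ?thesis using decr[of x y t] x by (auto simp: A_def)
  qed
  have neg: "u t x < 0" if "\<theta> t < x" "x \<le> c" for t x
  proof (rule ccontr)
    assume "\<not> u t x < 0"
    hence "x \<in> A t" using that ge_0[of t] by (auto simp: A_def)
    hence "x \<le> \<theta> t" unfolding \<theta>_def by (rule cSup_upper[OF _ bdd])
    thus False using that by simp
  qed
  have lim1: "((\<lambda>s. u s x) \<longlongrightarrow> u t x) (at t)" for t x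
    using cont1 by (simp add: continuous_on_eq_continuous_at isCont_def)
  have lim2: "(u t \<longlongrightarrow> u t x) (at x within S)" for t x S
    by (rule tendsto_within_subset[OF _ subset_UNIV])
      (use cont2 in \<open>simp add: continuous_on_eq_continuous_at isCont_def\<close>)
  show ?thesis
  proof (rule that)
    \<comment> \<open>At a fixed angle strictly below or above \<open>\<theta> t\<close> the sign of
      \<open>u\<close> persists for \<open>s\<close> near \<open>t\<close>, which bounds
      \<open>\<theta> s\<close> on that side.\<close>
    have "(\<theta> \<longlongrightarrow> \<theta> t) (at t)" for t
    proof (rule order_tendstoI)
      fix y assume y: "y < \<theta> t"
      define z where "z = (max y 0 + \<theta> t) / 2"
      show "eventually (\<lambda>s. y < \<theta> s) (at t)"
      proof (cases "y < 0")
        case True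
        hence "y < \<theta> s" for s using ge_0[of s] by linarith
        thus ?thesis by simp
      next
        case False
        hence z: "y < z" "0 \<le> z" "z < \<theta> t" using y by (auto simp: z_def)
        have "eventually (\<lambda>s. 0 < u s z) (at t)"
          using lim1 pos[OF z(2,3)] by (rule order_tendstoD)
        thus ?thesis
        proof eventually_elim
          case (elim s)
          show ?case using neg[of s z] elim z le_c[of t] by linarith
        qed
      qed
    next
      fix y assume y: "\<theta> t < y"
      define z where "z = (\<theta> t + y) / 2"
      show "eventually (\<lambda>s. \<theta> s < y) (at t)"
      proof (cases "y > c")
        case True
        hence "\<theta> s < y" for s using le_c[of s] by linarith
        thus ?thesis by simp
      next
        case False
        hence z: "\<theta> t < z" "z \<le> c" "z < y" using y by (auto simp: z_def)
        have "eventually (\<lambda>s. u s z < 0) (at t)"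
          using lim1 neg[OF z(1,2)] by (rule order_tendstoD)
        thus ?thesis
        proof eventually_elim
          case (elim s)
          show ?case using pos[of z s] elim z ge_0[of t] by linarith
        qed
      qed
    qed
    thus "continuous_on UNIV \<theta>" by (simp add: continuous_on_def)
    show "u t (\<theta> t) \<le> 0" if "\<theta> t < c" for t
    proof (rule tendsto_upperbound[OF lim2])
      show "eventually (\<lambda>x. u t x \<le> 0) (at_right (\<theta> t))"
        using eventually_at_right_real[OF that] by eventually_elim (use neg[of t] in force)
    qed simp
    show "0 \<le> u t (\<theta> t)" if "0 < \<theta> t" for t
    proof (rule tendsto_lowerbound[OF lim2])
      show "eventually (\<lambda>x. 0 \<le> u t x) (at_left (\<theta> t))"
        using eventually_at_left_real[OF that] by eventually_elim (use pos[of _ t] in \<open>auto intro!: less_imp_le\<close>)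
    qed simp
  qed (rule ge_0 le_c)+
qed

text \<open>\<open>Z\<close> collects exceptional values, not arguments: \<Psi> may be constant on
  an interval if its value lies in \<open>Z\<close>. A descent would pass through uncountably many
  values, so it passes some level \<open>c\<close> outside \<open>Z\<close>, where \<Psi> increases
  locally.\<close>

lemma local_increase_imp_mono:
  fixes \<Psi> :: "real \<Rightarrow> real"
  assumes cont: "continuous_on UNIV \<Psi>" and Z: "countable Z"
    and loc: "\<And>t. \<Psi> t \<notin> Z \<Longrightarrow> eventually (\<lambda>s. 0 < (\<Psi> s - \<Psi> t) * (s - t)) (at t)"
    and st: "s < t"
  shows "\<Psi> s \<le> \<Psi> t" and "\<Psi> s \<notin> Z \<Longrightarrow> \<Psi> s < \<Psi> t"
proof -
  have right: "\<exists>y. x < y \<and> y < b \<and> \<Psi> x < \<Psi> y" if "\<Psi> x \<notin> Z" "x < b" for x b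
  proof -
    have "eventually (\<lambda>s. 0 < (\<Psi> s - \<Psi> x) * (s - x)) (at_right x)"
      using loc[OF that(1)] by (simp add: eventually_at_split)
    hence "eventually (\<lambda>s. x < s \<and> s < b \<and> \<Psi> x < \<Psi> s) (at_right x)"
      using eventually_at_right_real[OF that(2)]
      by eventually_elim (auto simp: zero_less_mult_iff)
    thus ?thesis using eventually_happens' trivial_limit_at_right_real by blast
  qed
  have mono: "\<Psi> x \<le> \<Psi> y" if "x < y" for x y
  proof (rule ccontr)
    assume "\<not> \<Psi> x \<le> \<Psi> y"
    hence "uncountable {\<Psi> y<..<\<Psi> x}" using uncountable_open_interval by simp
    hence "\<not> {\<Psi> y<..<\<Psi> x} \<subseteq> Z" using Z countable_subset by blast
    then obtain c where c: "\<Psi> y < c" "c < \<Psi> x" "c \<notin> Z"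
      unfolding subset_iff greaterThanLessThan_iff by blast
    define A where "A = {r\<in>{x..y}. c \<le> \<Psi> r}"
    have "closed {r. c \<le> \<Psi> r}" by (intro closed_Collect_le continuous_intros cont)
    moreover have "A = {x..y} \<inter> {r. c \<le> \<Psi> r}" by (auto simp: A_def)
    ultimately have "closed A" by (simp add: closed_Int)
    moreover have "bounded A" unfolding A_def by (rule bounded_subset[OF bounded_closed_interval[of x y]]) auto
    moreover have "x \<in> A" using c that by (simp add: A_def)
    ultimately obtain m where m: "m \<in> A" "\<And>r. r \<in> A \<Longrightarrow> r \<le> m"
      using compact_attains_sup[of A] compact_eq_bounded_closed by blast
    have "\<exists>r\<ge>m. r \<le> y \<and> \<Psi> r = c"
      using m c by (intro IVT2' continuous_on_subset[OF cont]) (auto simp: A_def)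
    then obtain r where r: "m \<le> r" "r \<le> y" "\<Psi> r = c" by blast
    \<comment> \<open>Just to the right of \<open>r\<close> the function exceeds \<open>c\<close>,
      which is beyond the last point \<open>m\<close> of \<open>A\<close>.\<close>
    hence "r \<in> A" using m by (auto simp: A_def)
    moreover have "r < y" using r c by (cases "r = y") auto
    then obtain z where "r < z" "z < y" "c < \<Psi> z" using right[of r y] r c by auto
    hence "z \<in> A" using \<open>r \<in> A\<close> by (auto simp: A_def)
    ultimately show False using m(2)[of z] r \<open>r < z\<close> by simp
  qed
  show "\<Psi> s \<le> \<Psi> t" using mono st .
  assume "\<Psi> s \<notin> Z"
  then obtain y where "y < t" "\<Psi> s < \<Psi> y" using right st by blast
  thus "\<Psi> s < \<Psi> t" using mono[of y t] by simp
qed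

context angular_quotient
begin

text \<open>This has the sign of \<open>\<bar>H w\<bar> - a\<close>, but stays continuous at the poles of \<open>H\<close>.\<close>

definition level :: "real \<Rightarrow> complex \<Rightarrow> real" where
  "level a w = norm (exp (of_int p * w) * N (\<rho> w)) - a * norm (M (\<rho> w))"

lemma continuous_\<rho>: "continuous_on UNIV \<rho>"
  unfolding \<rho>_def by (intro continuous_intros)

lemma continuous_comp_\<rho>:
  assumes "f holomorphic_on - {0}"
  shows "continuous_on UNIV (\<lambda>w. f (\<rho> w))"
  by (rule continuous_on_compose2[OF holomorphic_on_imp_continuous_on[OF assms] continuous_\<rho>]) auto

lemmas continuous_N_\<rho> = continuous_comp_\<rho>[OF N_holomorphic]
lemmas continuous_M_\<rho> = continuous_comp_\<rho>[OF M_holomorphic]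

lemma continuous_level: "continuous_on UNIV (level a)"
  unfolding level_def by (intro continuous_intros continuous_N_\<rho> continuous_M_\<rho>)

text \<open>In the closed strip \<open>\<rho> w\<close> is positive only on the lower edge, so zeros
  of \<open>M\<close> can occur only there; likewise those of \<open>N\<close> only on the upper
  edge.\<close>

lemma M_\<rho>_nonzero:
  assumes "0 < Im w" "Im w \<le> pi / k"
  shows "M (\<rho> w) \<noteq> 0"
proof (cases "Im w = pi / k")
  case True
  hence "Re (\<rho> w) = - exp (k * Re w)" using k_pos by (simp add: \<rho>_def Re_exp)
  hence "\<not> Re (\<rho> w) > 0" by simp
  thus ?thesis using M_0D[of "\<rho> w"] by auto
qed (use assms strip_nonzero[of w] in \<open>auto simp: strip_def\<close>)

lemma N_\<rho>_nonzero:
  assumes "0 \<le> Im w" "Im w < pi / k"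
  shows "N (\<rho> w) \<noteq> 0"
proof (cases "Im w = 0")
  case True
  hence "Re (\<rho> w) = exp (k * Re w)" by (simp add: \<rho>_def Re_exp)
  hence "\<not> Re (\<rho> w) < 0" by simp
  thus ?thesis using N_0D[of "\<rho> w"] by auto
qed (use assms strip_nonzero[of w] in \<open>auto simp: strip_def\<close>)

text \<open>Inside the strip the modulus \<open>n / m\<close> of \<open>H\<close> decreases
  strictly. Multiplied out, the weak inequality extends by continuity to the edges, where
  \<open>m\<close> or \<open>n\<close> may vanish; two intermediate angles restore
  strictness.\<close>

lemma level_decreasing:
  assumes a: "a > 0" and xy: "0 \<le> x" "x < y" "y \<le> pi / k" and level: "0 \<le> level a (Complex t y)"
  shows "0 < level a (Complex t x)"
proof -
  define n where "n \<phi> = norm (exp (of_int p * Complex t \<phi>) * N (\<rho> (Complex t \<phi>)))" for \<phi>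
  define m where "m \<phi> = norm (M (\<rho> (Complex t \<phi>)))" for \<phi>
  have level_eq: "level a (Complex t \<phi>) = n \<phi> - a * m \<phi>" for \<phi>
    by (simp add: level_def n_def m_def)
  have C: "continuous_on UNIV (Complex t)"
    by (simp add: Complex_eq continuous_intros)
  have cn: "continuous_on UNIV n" and cm: "continuous_on UNIV m" unfolding n_def m_def
    by (intro continuous_intros C continuous_on_compose2[OF continuous_N_\<rho> C]
      continuous_on_compose2[OF continuous_M_\<rho> C]; simp)+
  have m_pos: "0 < m \<phi>" if "0 < \<phi>" "\<phi> \<le> pi / k" for \<phi>
    using M_\<rho>_nonzero[of "Complex t \<phi>"] that by (simp add: m_def)
  have strict: "n \<psi> * m \<phi> < n \<phi> * m \<psi>" if "0 < \<phi>" "\<phi> < \<psi>" "\<psi> < pi / k" for \<phi> \<psi>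
  proof -
    have "norm (H (Complex t \<psi>)) < norm (H (Complex t \<phi>))"
      using that by (intro norm_H_strict_antimono) (auto simp: strip_def)
    hence "n \<psi> / m \<psi> < n \<phi> / m \<phi>" by (simp add: H_def n_def m_def norm_mult norm_divide)
    thus ?thesis using m_pos[of \<phi>] m_pos[of \<psi>] that by (simp add: field_simps)
  qed
  have weak: "0 \<le> n \<phi> * m \<psi> - n \<psi> * m \<phi>" if "0 \<le> \<phi>" "\<phi> < \<psi>" "\<psi> \<le> pi / k" for \<phi> \<psi>
  proof -
    \<comment> \<open>Moves \<open>r\<close> the fraction \<open>s\<close> of the way to the middle
      of [0, pi / k], hence into the interior for \<open>0 < s < 1\<close>; then \<open>s\<close>
      tends to 0.\<close>
    define e where "e s r = r + s * (pi / k / 2 - r)" for s r :: real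
    have lim: "((\<lambda>s. f (e s r)) \<longlongrightarrow> f r) (at_right 0)" if "continuous_on UNIV f" for f :: "real \<Rightarrow> real" and r
    proof -
      have "continuous_on UNIV (\<lambda>s. f (e s r))"
        unfolding e_def by (rule continuous_on_compose2[OF that]) (auto intro!: continuous_intros)
      hence "((\<lambda>s. f (e s r)) \<longlongrightarrow> f (e 0 r)) (at 0)"
        by (simp add: continuous_on_eq_continuous_at isCont_def)
      hence "((\<lambda>s. f (e s r)) \<longlongrightarrow> f (e 0 r)) (at_right 0)"
        by (rule tendsto_within_subset[OF _ subset_UNIV])
      thus ?thesis by (simp add: e_def)
    qed
    have ev: "eventually (\<lambda>s. 0 \<le> n (e s \<phi>) * m (e s \<psi>) - n (e s \<psi>) * m (e s \<phi>)) (at_right 0)"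
      using eventually_at_right_real[of 0 1, simplified]
    proof eventually_elim
      case (elim s)
      hence s: "0 < s" "s < 1" by auto
      have conv: "e s r = (1 - s) * r + s * (pi / k / 2)" for r by (simp add: e_def algebra_simps)
      have "0 < s * (pi / k / 2)" using s k_pos by simp
      hence "0 < e s \<phi>" using s that unfolding conv by (intro add_nonneg_pos mult_nonneg_nonneg) auto
      moreover have "e s \<phi> < e s \<psi>" using s that unfolding conv by simp
      moreover have "e s \<psi> < pi / k"
      proof -
        have "(1 - s) * \<psi> \<le> (1 - s) * (pi / k)" using s that by (intro mult_left_mono) auto
        moreover have "s * (pi / k / 2) < s * (pi / k)" using s k_pos by (intro mult_strict_left_mono) (auto simp: field_simps)
        moreover have "(1 - s) * P + s * P = P" for P :: real by (simp add: left_diff_distrib)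
        note this[of "pi / k"]
        ultimately show ?thesis unfolding conv by linarith
      qed
      ultimately show ?case using strict[of "e s \<phi>" "e s \<psi>"] by simp
    qed
    show ?thesis
      by (rule tendsto_lowerbound[OF _ ev]) (intro tendsto_intros lim cn cm, simp)
  qed
  \<comment> \<open>The comparisons of \<open>y\<close> with \<psi> and of \<phi> with
    \<open>x\<close> may involve an edge and are weak; that of \<psi> with \<phi> is strict.\<close>
  obtain \<phi> where \<phi>: "x < \<phi>" "\<phi> < y" using dense[OF xy(2)] by blast
  obtain \<psi> where \<psi>: "\<phi> < \<psi>" "\<psi> < y" using dense[OF \<phi>(2)] by blast
  note pos = m_pos[of y] m_pos[of \<phi>] m_pos[of \<psi>]
  have "a * m y * m \<psi> \<le> n y * m \<psi>"
    using level by (intro mult_right_mono) (auto simp: level_eq m_def)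
  also have "\<dots> \<le> n \<psi> * m y" using weak[of \<psi> y] xy \<phi> \<psi> by simp
  finally have 1: "a * m \<psi> \<le> n \<psi>"
    using pos(1) xy by (simp add: mult.commute mult.left_commute mult_le_cancel_left)
  have "a * m \<psi> * m \<phi> \<le> n \<psi> * m \<phi>"
    using 1 by (intro mult_right_mono) (auto simp: m_def)
  also have "\<dots> < n \<phi> * m \<psi>" using strict[of \<phi> \<psi>] xy \<phi> \<psi> by simp
  finally have 2: "a * m \<phi> < n \<phi>"
    using pos(3) xy \<phi> \<psi> by (simp add: mult.commute mult.left_commute mult_less_cancel_left)
  show ?thesis
  proof (cases "m x = 0")
    \<comment> \<open>At a pole on the lower edge \<open>level\<close> reduces to
      \<open>n x\<close>, which is positive because \<open>N\<close> does not vanish there.\<close>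
    case True
    thus ?thesis using N_\<rho>_nonzero[of "Complex t x"] xy by (simp add: level_eq n_def)
  next
    case False
    hence mx: "0 < m x" by (simp add: m_def)
    have "a * m \<phi> * m x < n \<phi> * m x" using 2 mx by simp
    also have "\<dots> \<le> n x * m \<phi>" using weak[of x \<phi>] xy \<phi> by simp
    finally show ?thesis
      using pos(2) xy \<phi> by (simp add: level_eq mult.commute mult.left_commute mult_less_cancel_left)
  qed
qed

text \<open>The angle of \<open>X t\<close> is where \<open>level\<close> changes sign on the circle
  of radius \<open>exp t\<close>, or that of an edge. The curve avoids zeros and poles: on the upper
  edge \<open>level\<close> is nonnegative and \<open>M\<close> nonzero, on the lower edge
  \<open>level\<close> is nonpositive and \<open>N\<close> nonzero.\<close>

lemma ex_level_curve:
  assumes a: "a > 0"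
  obtains X where "continuous_on UNIV X" "\<And>t. Re (X t) = t"
    "\<And>t. 0 \<le> Im (X t)" "\<And>t. Im (X t) \<le> pi / k" "\<And>t. N (\<rho> (X t)) \<noteq> 0" "\<And>t. M (\<rho> (X t)) \<noteq> 0"
    "\<And>t. X t \<in> strip \<Longrightarrow> norm (H (X t)) = a"
    "\<And>x. x \<in> strip \<Longrightarrow> norm (H x) = a \<Longrightarrow> X (Re x) = x"
proof -
  have c: "0 < pi / k" using k_pos by simp
  have C: "continuous_on UNIV (\<lambda>t. level a (Complex t \<phi>))" "continuous_on UNIV (\<lambda>\<phi>. level a (Complex t \<phi>))" for t \<phi>
    unfolding Complex_eq
    by (rule continuous_on_compose2[OF continuous_level]; auto intro!: continuous_intros)+
  obtain \<theta> where \<theta>: "continuous_on UNIV \<theta>" "\<And>t. 0 \<le> \<theta> t" "\<And>t. \<theta> t \<le> pi / k"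
    and le: "\<And>t. \<theta> t < pi / k \<Longrightarrow> level a (Complex t (\<theta> t)) \<le> 0"
    and ge: "\<And>t. 0 < \<theta> t \<Longrightarrow> 0 \<le> level a (Complex t (\<theta> t))"
    by (rule monotone_level_function[OF c C level_decreasing[OF a]]) auto
  have level_norm: "level a x = 0 \<longleftrightarrow> norm (H x) = a" if "x \<in> strip" for x
    using strip_nonzero[OF that] by (simp add: level_def H_def norm_mult norm_divide field_simps)
  define X where "X t = Complex t (\<theta> t)" for t
  show ?thesis
  proof (rule that[of X])
    show "continuous_on UNIV X" unfolding X_def Complex_eq by (intro continuous_intros \<theta>)
    fix t
    show "Re (X t) = t" "0 \<le> Im (X t)" "Im (X t) \<le> pi / k" using \<theta> by (auto simp: X_def)
    show "N (\<rho> (X t)) \<noteq> 0"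
    proof (cases "\<theta> t < pi / k")
      case False
      hence "0 < \<theta> t" using c by linarith
      hence "0 \<le> level a (X t)" "M (\<rho> (X t)) \<noteq> 0"
        using ge[of t] M_\<rho>_nonzero[of "X t"] \<theta>(3)[of t] by (auto simp: X_def)
      thus ?thesis using a by (auto simp: level_def mult_le_0_iff)
    qed (use N_\<rho>_nonzero[of "X t"] \<theta>(2)[of t] in \<open>auto simp: X_def\<close>)
    show "M (\<rho> (X t)) \<noteq> 0"
    proof (cases "0 < \<theta> t")
      case False
      hence "\<theta> t = 0" using \<theta>(2)[of t] by simp
      hence "level a (X t) \<le> 0" "N (\<rho> (X t)) \<noteq> 0"
        using le[of t] N_\<rho>_nonzero[of "X t"] c by (auto simp: X_def)
      thus ?thesis by (auto simp: level_def)
    qed (use M_\<rho>_nonzero[of "X t"] \<theta>(3)[of t] in \<open>auto simp: X_def\<close>)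
    show "norm (H (X t)) = a" if "X t \<in> strip"
      using that le[of t] ge[of t] level_norm[OF that] by (auto simp: X_def strip_def)
  next
    fix x assume x: "x \<in> strip" "norm (H x) = a"
    define t where "t = Re x"
    have x_eq: "x = Complex t (Im x)" by (simp add: t_def)
    have lx: "level a (Complex t (Im x)) = 0" using x level_norm x_eq by simp
    have ix: "0 < Im x" "Im x < pi / k" using x by (auto simp: strip_def)
    have "\<not> \<theta> t < Im x"
    proof
      assume *: "\<theta> t < Im x"
      hence "0 < level a (Complex t (\<theta> t))"
        using level_decreasing[OF a, of "\<theta> t" "Im x" t] \<theta> lx ix by auto
      thus False using le[of t] * ix by auto
    qed
    moreover have "\<not> Im x < \<theta> t"
    proof
      assume *: "Im x < \<theta> t"
      hence "0 < level a (Complex t (Im x))"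
        using level_decreasing[OF a, of "Im x" "\<theta> t" t] \<theta> ge[of t] ix by auto
      thus False using lx by simp
    qed
    ultimately have "\<theta> t = Im x" by simp
    thus "X (Re x) = x" using x_eq by (simp add: X_def t_def)
  qed
qed

section \<open>The argument along the level curve\<close>

lemma boundary_Im_H_power:
  assumes "Im w = 0 \<or> Im w = pi / k"
  shows "Im (H w ^ k) = 0"
proof -
  have "sin (real k * Im w) = 0" using assms k_pos by auto
  hence "Im (exp w ^ k) = 0" unfolding \<rho>_eq[symmetric] Im_\<rho> by simp
  thus ?thesis using Im_power_k_nonzero[of "exp w"] by (auto simp: g_exp)
qed

text \<open>\<Psi> is the imaginary part of a continuous logarithm of \<open>H\<close> along the
  curve. Where \<open>sin (k * \<Psi> t)\<close> is nonzero the curve is inside the strip and the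
  modulus is \<open>a\<close>, so the increment inequality makes \<Psi> increase locally. The other
  values of \<Psi> lie in the countable set of multiples of \<open>pi / k\<close>.\<close>

lemma level_curve_arg:
  assumes a: "a > 0"
  obtains X :: "real \<Rightarrow> complex" and \<Psi> :: "real \<Rightarrow> real" where "continuous_on UNIV \<Psi>" "\<And>t. Re (X t) = t"
    "\<And>t. sin (k * \<Psi> t) \<noteq> 0 \<Longrightarrow> X t \<in> strip \<and> H (X t) = of_real a * cis (\<Psi> t)"
    "\<And>x. x \<in> strip \<Longrightarrow> norm (H x) = a \<Longrightarrow> X (Re x) = x \<and> H x = of_real a * cis (\<Psi> (Re x))"
    "\<And>s t. s < t \<Longrightarrow> \<Psi> s \<le> \<Psi> t" "\<And>s t. s < t \<Longrightarrow> sin (k * \<Psi> s) \<noteq> 0 \<Longrightarrow> \<Psi> s < \<Psi> t"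
proof -
  obtain X where X: "continuous_on UNIV X" "\<And>t. Re (X t) = t"
    and Im_X: "\<And>t. 0 \<le> Im (X t)" "\<And>t. Im (X t) \<le> pi / k"
    and nz: "\<And>t. N (\<rho> (X t)) \<noteq> 0" "\<And>t. M (\<rho> (X t)) \<noteq> 0"
    and norm_HX: "\<And>t. X t \<in> strip \<Longrightarrow> norm (H (X t)) = a"
    and X_eqI: "\<And>x. x \<in> strip \<Longrightarrow> norm (H x) = a \<Longrightarrow> X (Re x) = x"
    using ex_level_curve[OF a] by blast
  have cont_HX: "continuous_on UNIV (\<lambda>t. H (X t))" unfolding H_def
    by (intro continuous_intros X continuous_on_compose2[OF continuous_N_\<rho> X(1)]
      continuous_on_compose2[OF continuous_M_\<rho> X(1)]) (auto simp: nz)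
  have HX_nz: "H (X t) \<noteq> 0" for t using nz by (simp add: H_def)
  \<comment> \<open>\<open>log_H\<close> lives only inside the strip, while the curve may run along
    an edge; hence a separate logarithm along the curve.\<close>
  obtain L where L: "continuous_on UNIV L" "\<And>t. H (X t) = exp (L t)"
    using continuous_logarithm_on_contractible[OF cont_HX convex_imp_contractible[OF convex_UNIV]] HX_nz
    by auto
  define \<Psi> where "\<Psi> t = Im (L t)" for t
  have cont_\<Psi>: "continuous_on UNIV \<Psi>" unfolding \<Psi>_def by (intro continuous_intros L)
  have HX: "H (X t) = of_real (norm (H (X t))) * cis (\<Psi> t)" for t
    by (metis L(2) exp_eq_polar norm_exp_eq_Re \<Psi>_def)
  have interior: "X t \<in> strip" if "sin (k * \<Psi> t) \<noteq> 0" for t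
  proof (rule ccontr)
    assume "X t \<notin> strip"
    hence "Im (H (X t) ^ k) = 0"
      using Im_X[of t] by (intro boundary_Im_H_power) (auto simp: strip_def)
    moreover have "H (X t) ^ k = of_real (norm (H (X t)) ^ k) * cis (k * \<Psi> t)"
      by (subst HX) (simp add: power_mult_distrib Complex.DeMoivre)
    ultimately show False using that HX_nz[of t] by simp
  qed
  define Z where "Z = range (\<lambda>i::int. i * pi / k)"
  have Z: "s \<in> Z \<longleftrightarrow> sin (k * s) = 0" for s :: real
    using k_pos by (auto simp: Z_def sin_zero_iff_int2 field_simps)
  have loc: "eventually (\<lambda>s. 0 < (\<Psi> s - \<Psi> t) * (s - t)) (at t)" if "\<Psi> t \<notin> Z" for t
  proof -
    have t: "X t \<in> strip" using interior that Z by blast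
    have cX: "isCont X t" using X(1) by (simp add: continuous_on_eq_continuous_at)
    have "isCont log_H (X t)" using log_H(2)[OF t] by (rule DERIV_isCont)
    hence cK: "isCont (\<lambda>s. log_H (X s)) t" using cX isCont_o2 by blast
    have "eventually (\<lambda>s. X s \<in> strip) (at t)"
      using cX open_strip t unfolding isCont_def by (rule topological_tendstoD)
    moreover have "eventually (\<lambda>s. dist (log_H (X s)) (log_H (X t)) < 1) (at t)"
      using cK unfolding isCont_def by (rule tendstoD) simp
    moreover have "eventually (\<lambda>s. dist (L s) (L t) < 1) (at t)"
      using L(1) by (intro tendstoD) (auto simp: continuous_on_eq_continuous_at isCont_def)
    moreover have "eventually (\<lambda>s. s \<noteq> t) (at t)" by (simp add: eventually_at_filter)
    ultimately show ?thesis
    proof eventually_elim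
      case (elim s)
      have "exp (log_H (X s)) = exp (L s)" "exp (log_H (X t)) = exp (L t)"
        using L(2) log_H(1) elim(1) t by metis+
      then obtain m n :: int where mn: "log_H (X s) = L s + (of_int (2 * m) * pi) * \<i>"
          "log_H (X t) = L t + (of_int (2 * n) * pi) * \<i>"
        unfolding exp_eq by metis
      \<comment> \<open>Both logarithms move by less than 1 between \<open>t\<close> and
        \<open>s\<close>, so the multiple of \<open>2 * pi\<close> by which they differ stays the
        same.\<close>
      have d1: "\<bar>Im (log_H (X s)) - Im (log_H (X t))\<bar> < 1"
        using elim(2) abs_Im_le_cmod[of "log_H (X s) - log_H (X t)"] by (simp add: dist_norm)
      have d2: "\<bar>\<Psi> s - \<Psi> t\<bar> < 1"
        using elim(3) abs_Im_le_cmod[of "L s - L t"] by (simp add: dist_norm \<Psi>_def)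
      have Im_mn: "Im (log_H (X s)) = \<Psi> s + 2 * m * pi" "Im (log_H (X t)) = \<Psi> t + 2 * n * pi"
        by (simp_all add: mn \<Psi>_def)
      have "\<bar>real_of_int (m - n)\<bar> * (2 * pi) < 2"
      proof -
        have "2 * m * pi - 2 * n * pi = real_of_int (m - n) * (2 * pi)"
          by (simp add: algebra_simps)
        hence "\<bar>real_of_int (m - n)\<bar> * (2 * pi) = \<bar>2 * m * pi - 2 * n * pi\<bar>"
          by (simp only: abs_mult) simp
        also have "\<dots> < 2" using d1 d2 Im_mn by linarith
        finally show ?thesis .
      qed
      hence "m = n"
      proof (rule contrapos_pp)
        assume "m \<noteq> n"
        hence "1 \<le> \<bar>real_of_int (m - n)\<bar>" by linarith
        hence "1 * (2 * pi) \<le> \<bar>real_of_int (m - n)\<bar> * (2 * pi)" by (intro mult_right_mono) auto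
        thus "\<not> \<bar>real_of_int (m - n)\<bar> * (2 * pi) < 2" using pi_gt3 by linarith
      qed
      hence Im: "Im (log_H (X s)) - Im (log_H (X t)) = \<Psi> s - \<Psi> t" using Im_mn by simp
      \<comment> \<open>With equal moduli the increment of \<open>log_H\<close> is purely imaginary,
        and the increment inequality reduces to the claim.\<close>
      have "Re (log_H (X s)) = Re (log_H (X t))"
        using norm_HX[OF elim(1)] norm_HX[OF t] norm_H[OF elim(1)] norm_H[OF t]
        by (metis exp_inj_iff)
      moreover have "X t \<noteq> X s" using X(2) elim(4) by metis
      ultimately show "0 < (\<Psi> s - \<Psi> t) * (s - t)"
        using log_H_increment[OF t elim(1)] Im X(2) by simp
    qed
  qed
  have countable_Z: "countable Z" by (simp add: Z_def)
  note mono = local_increase_imp_mono[OF cont_\<Psi> countable_Z loc, unfolded Z]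
  show ?thesis
  proof (rule that[OF cont_\<Psi> X(2)])
    show "X t \<in> strip \<and> H (X t) = of_real a * cis (\<Psi> t)" if "sin (k * \<Psi> t) \<noteq> 0" for t
      using interior[OF that] HX[of t] norm_HX[of t] by simp
    show "X (Re x) = x \<and> H x = of_real a * cis (\<Psi> (Re x))" if "x \<in> strip" "norm (H x) = a" for x
      using X_eqI[OF that] HX[of "Re x"] that by simp
  qed (use mono in blast)+
qed

end

section \<open>Consecutive points\<close>

lemma cis_eq_iff: "cis x = cis y \<longleftrightarrow> (\<exists>n::int. x = y + 2 * pi * n)"
  using sin_cos_eq_iff[of x y] by (auto simp: complex_eq_iff)

context angular_quotient
begin

text \<open>Rotations of \<open>X\<close> give \<alpha>-points where \<Psi> has the form
  \<open>\<beta> + c * j\<close>, rotations of its reflection where it has the form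
  \<open>- \<beta> + c * j\<close>. The two kinds alternate, so an even sector is followed by an odd
  one, and the congruence fixes the rotation \<open>l\<close>.\<close>

theorem consecutive_points_even_sector:
  assumes \<alpha>: "Im (\<alpha> ^ k) \<noteq> 0" "\<alpha> \<in> Q_sector k n"
    and z: "g z = \<alpha>" "z \<in> Q_sector k (2 * m)" and w: "g w = \<alpha>" "norm z < norm w"
    and consecutive: "\<And>u. g u = \<alpha> \<Longrightarrow> norm z < norm u \<Longrightarrow> \<not> norm u < norm w"
    and l: "[p * (l + m) = n + 1] (mod int k)"
  shows "w \<in> Q_sector k (2 * l - 1)"
proof -
  define a where "a = norm \<alpha>"
  have a: "0 < a" using \<alpha>(1) k_pos by (auto simp: a_def)
  obtain X :: "real \<Rightarrow> complex" and \<Psi> :: "real \<Rightarrow> real"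
    where cont: "continuous_on UNIV \<Psi>" and Re_X: "\<And>t. Re (X t) = t"
      and interior: "\<And>t. sin (k * \<Psi> t) \<noteq> 0 \<Longrightarrow> X t \<in> strip \<and> H (X t) = of_real a * cis (\<Psi> t)"
      and on_curve: "\<And>x. x \<in> strip \<Longrightarrow> norm (H x) = a \<Longrightarrow>
        X (Re x) = x \<and> H x = of_real a * cis (\<Psi> (Re x))"
      and "\<And>s t. s < t \<Longrightarrow> \<Psi> s \<le> \<Psi> t"
      and strict: "\<And>s t. s < t \<Longrightarrow> sin (k * \<Psi> s) \<noteq> 0 \<Longrightarrow> \<Psi> s < \<Psi> t"
    by (rule level_curve_arg[OF a]) (rule that)
  define c where "c = 2 * pi / k"
  have c: "c > 0" using k_pos by (simp add: c_def)
  have rot: "rot j = cis (c * j)" for j by (simp add: rot_def c_def)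

  obtain y where y: "y \<in> strip" "\<alpha> = cis (pi * of_int n / k) * exp y"
    using \<alpha>(2) mem_Q_sector_iff by blast
  define \<beta> where "\<beta> = pi * of_int n / k + Im y"
  have \<alpha>_polar: "\<alpha> = of_real a * cis \<beta>"
    by (simp add: a_def \<beta>_def y norm_mult exp_eq_polar[of y] flip: cis_mult)
  \<comment> \<open>For every integer \<open>J\<close> this places
    \<open>- \<beta> + c * (n + 1 + J)\<close> strictly between \<open>\<beta> + c * J\<close> and
    \<open>\<beta> + c * (J + 1)\<close>.\<close>
  have \<beta>: "of_int n * c < 2 * \<beta>" "2 * \<beta> < of_int n * c + c"
    using y(1) k_pos by (auto simp: \<beta>_def c_def strip_def field_simps)

  obtain x where x: "x \<in> strip" "z = rot m * exp x" using z(2) mem_Q_sector_even_iff by blast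
  define s where "s = Re x"
  have norm_z: "norm z = exp s" by (simp add: x norm_mult s_def)
  have Hx: "\<alpha> = rot (p * m) * H x" using z(1) by (simp add: x g_rot g_exp)
  have "norm (H x) = a" by (simp add: a_def Hx norm_mult)
  from on_curve[OF x(1) this] have "\<alpha> = rot (p * m) * (of_real a * cis (\<Psi> s))"
    by (simp add: Hx s_def)
  hence "cis (\<Psi> s + c * (p * m)) = cis \<beta>"
    using a \<alpha>_polar by (simp add: rot cis_mult add.commute)
  then obtain i :: int where i: "\<Psi> s + c * (p * m) = \<beta> + 2 * pi * i" using cis_eq_iff by blast
  \<comment> \<open>The \<open>i\<close> full turns are \<open>k * i\<close> steps of length
    \<open>c\<close>; modulo \<open>k\<close>, \<open>J\<close> is \<open>- p * m\<close>.\<close>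
  define J where "J = int k * i - p * m"
  have "c * J = 2 * pi * i - c * (p * m)" using k_pos by (simp add: J_def c_def field_simps)
  hence \<Psi>s: "\<Psi> s = \<beta> + c * J" using i by simp

  have sin_k\<beta>: "sin (k * \<beta>) \<noteq> 0"
    using \<alpha>(1) by (simp add: \<alpha>_polar power_mult_distrib Complex.DeMoivre flip: of_real_power)
  have cis_k: "cis (k * (\<gamma> + c * j)) = cis (k * \<gamma>)" for \<gamma> :: real and j :: int
  proof -
    have "k * (\<gamma> + c * j) = k * \<gamma> + 2 * pi * j" using k_pos by (simp add: c_def field_simps)
    thus ?thesis using cis_eq_iff by blast
  qed
  have "sin (k * \<Psi> s) \<noteq> 0"
    using sin_k\<beta> arg_cong[OF cis_k[of \<beta> J], of Im] by (simp add: \<Psi>s)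
  \<comment> \<open>The least element above \<open>\<Psi> s\<close> of the set where \<open>\<Psi>\<close> belongs to an \<open>\<alpha>\<close>-point.\<close>
  define v where "v = - \<beta> + c * (n + 1 + J)"
  have sin_v: "sin (k * v) \<noteq> 0"
    using sin_k\<beta> arg_cong[OF cis_k[of "- \<beta>" "n + 1 + J"], of Im] by (simp add: v_def)
  have "[p * l = n + 1 + J] (mod int k)"
  proof -
    have "[p * (l + m) - p * m = n + 1 - p * m] (mod int k)" using l by (rule cong_diff) simp
    hence "[p * l = n + 1 - p * m] (mod int k)" by (simp add: algebra_simps)
    moreover have "[n + 1 - p * m = n + 1 + J] (mod int k)"
      by (simp add: J_def cong_iff_dvd_diff)
    ultimately show ?thesis by (rule cong_trans)
  qed
  hence "rot (p * l) = cis (c * (n + 1 + J))" by (simp only: rot[symmetric] rot_eq_iff cong_sym)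
  hence v: "of_real a * cis v = rot (p * l) * cnj \<alpha>"
    by (simp add: v_def \<alpha>_polar cis_cnj cis_mult add.commute)
  \<comment> \<open>At every radius where \<Psi> takes the value \<open>v\<close>, the reflection of
    \<open>X r\<close> rotated by \<open>l\<close> is an \<alpha>-point in the required
    sector.\<close>
  have point: "\<exists>u. g u = \<alpha> \<and> norm u = exp r \<and> u \<in> Q_sector k (2 * l - 1)" if "\<Psi> r = v" for r
  proof (intro exI conjI)
    let ?u = "rot l * cnj (exp (X r))"
    have X: "X r \<in> strip" "H (X r) = rot (p * l) * cnj \<alpha>"
      using interior[of r] sin_v that v by auto
    have "g ?u = rot (p * l) * cnj (H (X r))" by (simp add: g_rot g_cnj g_exp del: exp_cnj)
    thus "g ?u = \<alpha>" by (simp add: X cnj_rot mult.assoc flip: rot_add)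
      (simp add: rot_add[symmetric] mult.assoc[symmetric] rot_eq_1_iff)
    show "norm ?u = exp r" by (simp add: norm_mult Re_X)
    show "?u \<in> Q_sector k (2 * l - 1)" using rot_cnj_mem_Q_sector[OF X(1)] .
  qed

  define t where "t = ln (norm w)"
  have "norm w > 0" using w(2) norm_ge_zero[of z] by linarith
  hence norm_w: "norm w = exp t" by (simp add: t_def)
  hence "s < t" using w(2) norm_z by simp
  have gt: "\<Psi> s < \<Psi> t" using strict \<open>s < t\<close> \<open>sin (k * \<Psi> s) \<noteq> 0\<close> by blast
  have "Im (g w ^ k) \<noteq> 0" using \<alpha>(1) w(1) by simp
  then obtain j :: int where j: "\<Psi> t = \<beta> + c * j \<or> \<Psi> t = - \<beta> + c * j"
  proof (cases rule: g_representation)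
    case (1 x' i)
    hence "H x' = of_real a * cis (\<Psi> t)" using on_curve[of x'] w(1) by (simp add: a_def t_def)
    hence "\<alpha> = of_real a * (rot (p * i) * cis (\<Psi> t))" using 1(5) w(1) by simp
    hence "cis (\<Psi> t + c * (p * i)) = cis \<beta>" using a \<alpha>_polar by (simp add: rot cis_mult add.commute)
    then obtain q :: int where "\<Psi> t + c * (p * i) = \<beta> + 2 * pi * q" using cis_eq_iff by blast
    hence "\<Psi> t = \<beta> + c * (int k * q - p * i)" using k_pos by (simp add: c_def field_simps)
    thus ?thesis using that by blast
  next
    case (2 x' i)
    hence "H x' = of_real a * cis (\<Psi> t)" using on_curve[of x'] w(1) by (simp add: a_def t_def)
    hence "\<alpha> = of_real a * (rot (p * i) * cis (- \<Psi> t))"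
      using 2(5) w(1) by (simp add: cis_cnj)
    hence "cis (c * (p * i) - \<Psi> t) = cis \<beta>" using a \<alpha>_polar by (simp add: rot cis_mult)
    then obtain q :: int where "c * (p * i) - \<Psi> t = \<beta> + 2 * pi * q" using cis_eq_iff by blast
    hence "\<Psi> t = - \<beta> + c * (p * i - int k * q)" using k_pos by (simp add: c_def field_simps)
    thus ?thesis using that by blast
  qed
  \<comment> \<open>Otherwise \<Psi> takes the value \<open>v\<close> strictly between
    \<open>s\<close> and \<open>t\<close>, which produces an \<alpha>-point between \<open>z\<close>
    and \<open>w\<close>.\<close>
  have "\<not> v < \<Psi> t"
  proof
    assume "v < \<Psi> t"
    moreover have "\<Psi> s < v" using \<beta> by (simp add: \<Psi>s v_def algebra_simps)
    ultimately obtain r where r: "s \<le> r" "r \<le> t" "\<Psi> r = v"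
      using IVT'[of \<Psi> s v t] \<open>s < t\<close> continuous_on_subset[OF cont] by auto
    hence "s < r" "r < t" using \<open>\<Psi> s < v\<close> \<open>v < \<Psi> t\<close> by (auto simp: less_le)
    moreover obtain u where "g u = \<alpha>" "norm u = exp r" using point[OF r(3)] by blast
    ultimately show False using consecutive[of u] norm_z norm_w by simp
  qed
  \<comment> \<open>No value of either form lies strictly between \<open>\<Psi> s\<close> and
    \<open>v\<close>.\<close>
  moreover have "\<not> \<Psi> t < v"
  proof
    assume lt: "\<Psi> t < v"
    from j show False
    proof
      assume *: "\<Psi> t = \<beta> + c * j"
      hence "J < j" using gt c by (simp add: \<Psi>s)
      hence "real_of_int J + 1 \<le> j" by linarith
      hence "c * (J + 1) \<le> c * j" using c by (intro mult_left_mono) auto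
      thus False using lt * \<beta> by (simp add: v_def algebra_simps)
    next
      assume *: "\<Psi> t = - \<beta> + c * j"
      hence "real_of_int j < n + 1 + J" using lt c by (simp add: v_def)
      hence "j \<le> n + J" unfolding of_int_less_iff by simp
      hence "real_of_int j \<le> n + J" by (simp only: of_int_le_iff)
      hence "c * j \<le> c * (n + J)" using c by (intro mult_left_mono) auto
      thus False using gt * \<beta> by (simp add: \<Psi>s algebra_simps)
    qed
  qed
  ultimately have "\<Psi> t = v" by simp
  \<comment> \<open>This \<alpha>-point lies on the circle of \<open>w\<close>, so uniqueness on
    circles identifies the two.\<close>
  from point[OF this] obtain u where u: "g u = \<alpha>" "norm u = norm w" "u \<in> Q_sector k (2 * l - 1)"
    unfolding norm_w by blast
  hence "u = w" using w(1) \<alpha>(1) eq_if_norm_eq[of u w] by simp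
  thus ?thesis using u by simp
qed

text \<open>Conjugation reduces this to the even case: it sends \<open>n\<close> to
  \<open>- n - 1\<close>, the index \<open>2 * m - 1\<close> to \<open>2 * (- m)\<close>, and
  \<open>l\<close> to \<open>- l\<close>.\<close>

theorem consecutive_points_odd_sector:
  assumes \<alpha>: "Im (\<alpha> ^ k) \<noteq> 0" "\<alpha> \<in> Q_sector k n"
    and z: "g z = \<alpha>" "z \<in> Q_sector k (2 * m - 1)" and w: "g w = \<alpha>" "norm z < norm w"
    and consecutive: "\<And>u. g u = \<alpha> \<Longrightarrow> norm z < norm u \<Longrightarrow> \<not> norm u < norm w"
    and l: "[p * (l + m) = n] (mod int k)"
  shows "w \<in> Q_sector k (2 * l)"
proof -
  have "cnj w \<in> Q_sector k (2 * (- l) - 1)"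
  proof (rule consecutive_points_even_sector)
    show "Im (cnj \<alpha> ^ k) \<noteq> 0" using \<alpha>(1) by (simp flip: complex_cnj_power)
    show "cnj \<alpha> \<in> Q_sector k (- n - 1)" by (rule cnj_mem_Q_sector[OF \<alpha>(2)]) simp
    show "g (cnj z) = cnj \<alpha>" "g (cnj w) = cnj \<alpha>" "norm (cnj z) < norm (cnj w)"
      using z w by (simp_all add: g_cnj)
    show "cnj z \<in> Q_sector k (2 * - m)" by (rule cnj_mem_Q_sector[OF z(2)]) simp
    show "\<not> norm u < norm (cnj w)" if "g u = cnj \<alpha>" "norm (cnj z) < norm u" for u
      using consecutive[of "cnj u"] that by (simp add: g_cnj)
    have "[- (p * (l + m)) = - n] (mod int k)" using l by (simp add: cong_minus_minus_iff)
    thus "[p * (- l + - m) = - n - 1 + 1] (mod int k)" by (simp add: algebra_simps)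
  qed
  from cnj_mem_Q_sector[OF this, of "2 * l"] show ?thesis by simp
qed

end

section \<open>The products of the theorem\<close>

lemma lin_prod_DERIV:
  assumes "\<And>n. t n \<ge> 0" "summable t"
  shows "(lin_prod t has_field_derivative deriv (lin_prod t) z) (at z)"
  using lin_prod_holomorphic[OF assms] by (rule holomorphic_derivI) auto

lemma Im_inverse_sign:
  assumes "\<zeta> \<noteq> 0"
  shows "Im \<zeta> = - ((norm \<zeta>)\<^sup>2 * Im (1 / \<zeta>))"
  using assms by (simp add: Im_divide cmod_power2 complex_eq_iff)

text \<open>In \<open>e3\<close> a term \<open>L\<close> carries a minus sign exactly when its
  argument lies in the half plane opposite to that of \<zeta>. After multiplication by
  \<open>Im \<zeta>\<close> every summand is therefore nonnegative, and \<open>nontrivial\<close>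
  makes one positive.\<close>

lemma angular_quotient_lin_prods:
  fixes ta tb tc td :: "nat \<Rightarrow> real"
  assumes k: "k \<ge> 2" "coprime p (int k)" and A: "A \<ge> 0" "A\<^sub>0 \<ge> 0"
    and ta: "\<And>n. ta n \<ge> 0" "summable ta" and tb: "\<And>n. tb n \<ge> 0" "summable tb"
    and tc: "\<And>n. tc n \<ge> 0" "summable tc" and td: "\<And>n. td n \<ge> 0" "summable td"
    and nontrivial: "A \<noteq> 0 \<or> A\<^sub>0 \<noteq> 0 \<or> (\<exists>n. ta n \<noteq> 0 \<or> tb n \<noteq> 0 \<or> tc n \<noteq> 0 \<or> td n \<noteq> 0)"
  shows "angular_quotient k p
    (\<lambda>\<zeta>. exp (of_real A * \<zeta> + of_real A\<^sub>0 / \<zeta>) * lin_prod ta \<zeta> * lin_prod tc (1 / \<zeta>))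
    (\<lambda>\<zeta>. lin_prod tb (- \<zeta>) * lin_prod td (- 1 / \<zeta>))"
    (is "angular_quotient k p ?N ?M")
proof
  note DERIV = lin_prod_DERIV[OF ta] lin_prod_DERIV[OF tb] lin_prod_DERIV[OF tc] lin_prod_DERIV[OF td]
  note cnjs = lin_prod_cnj[OF ta] lin_prod_cnj[OF tb] lin_prod_cnj[OF tc] lin_prod_cnj[OF td]
  define DN where "DN \<zeta> = exp (of_real A * \<zeta> + of_real A\<^sub>0 / \<zeta>) * (of_real A - of_real A\<^sub>0 / \<zeta>\<^sup>2)
        * lin_prod ta \<zeta> * lin_prod tc (1 / \<zeta>)
      + exp (of_real A * \<zeta> + of_real A\<^sub>0 / \<zeta>) * deriv (lin_prod ta) \<zeta> * lin_prod tc (1 / \<zeta>)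
      - exp (of_real A * \<zeta> + of_real A\<^sub>0 / \<zeta>) * lin_prod ta \<zeta>
        * (deriv (lin_prod tc) (1 / \<zeta>) / \<zeta>\<^sup>2)" for \<zeta>
  define DM where "DM \<zeta> = lin_prod tb (- \<zeta>) * (deriv (lin_prod td) (- 1 / \<zeta>) / \<zeta>\<^sup>2)
      - deriv (lin_prod tb) (- \<zeta>) * lin_prod td (- 1 / \<zeta>)" for \<zeta>
  have dN: "(?N has_field_derivative DN \<zeta>) (at \<zeta>)" if "\<zeta> \<noteq> 0" for \<zeta>
    by (rule derivative_eq_intros DERIV DERIV_chain2[OF DERIV(1)] DERIV_chain2[OF DERIV(3)] that refl)+
      (use that in \<open>simp add: DN_def field_simps power2_eq_square\<close>)
  have dM: "(?M has_field_derivative DM \<zeta>) (at \<zeta>)" if "\<zeta> \<noteq> 0" for \<zeta>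
    by (rule derivative_eq_intros DERIV_chain2[OF DERIV(2)] DERIV_chain2[OF DERIV(4)] that refl)+
      (use that in \<open>simp add: DM_def field_simps power2_eq_square\<close>)
  show "k \<ge> 2" "coprime p (int k)" by fact+
  show "?N holomorphic_on - {0}" "?M holomorphic_on - {0}"
    using dN dM by (auto simp: holomorphic_on_open open_Compl)
  fix \<zeta> :: complex
  show "?N (cnj \<zeta>) = cnj (?N \<zeta>)" "?M (cnj \<zeta>) = cnj (?M \<zeta>)"
    using cnjs(1)[of \<zeta>] cnjs(2)[of "- \<zeta>"] cnjs(3)[of "1 / \<zeta>"] cnjs(4)[of "- 1 / \<zeta>"]
    by (simp_all add: exp_cnj)
  {
    assume "\<zeta> \<noteq> 0" "?N \<zeta> = 0"
    then consider "lin_prod ta \<zeta> = 0" | "lin_prod tc (1 / \<zeta>) = 0" by auto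
    thus "Im \<zeta> = 0 \<and> Re \<zeta> < 0"
    proof cases
      case 1
      thus ?thesis using lin_prod_0D[OF ta] by blast
    next
      case 2
      hence "Im (1 / \<zeta>) = 0" "Re (1 / \<zeta>) < 0" using lin_prod_0D[OF tc] by blast+
      thus ?thesis by (auto simp: Im_divide Re_divide divide_less_0_iff complex_eq_iff)
    qed
  }
  {
    assume "\<zeta> \<noteq> 0" "?M \<zeta> = 0"
    then consider "lin_prod tb (- \<zeta>) = 0" | "lin_prod td (- 1 / \<zeta>) = 0" by auto
    thus "Im \<zeta> = 0 \<and> Re \<zeta> > 0"
    proof cases
      case 1
      thus ?thesis using lin_prod_0D[OF tb, of "- \<zeta>"] by simp
    next
      case 2
      hence "Im (- 1 / \<zeta>) = 0" "Re (- 1 / \<zeta>) < 0" using lin_prod_0D[OF td] by blast+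
      thus ?thesis by (auto simp: Im_divide Re_divide divide_less_0_iff zero_less_divide_iff complex_eq_iff)
    qed
  }
  assume Im: "Im \<zeta> \<noteq> 0"
  hence \<zeta>: "\<zeta> \<noteq> 0" by auto
  define L where "L t \<eta> = \<eta> * (deriv (lin_prod t) \<eta> / lin_prod t \<eta>)" for t and \<eta> :: complex
  have Im': "Im (- \<zeta>) \<noteq> 0" "Im (1 / \<zeta>) \<noteq> 0" "Im (- 1 / \<zeta>) \<noteq> 0"
    using Im \<zeta> Im_inverse_sign[OF \<zeta>] by auto
  have nz: "lin_prod ta \<zeta> \<noteq> 0" "lin_prod tb (- \<zeta>) \<noteq> 0" "lin_prod tc (1 / \<zeta>) \<noteq> 0"
      "lin_prod td (- 1 / \<zeta>) \<noteq> 0"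
    using Im Im' lin_prod_0D[OF ta] lin_prod_0D[OF tb] lin_prod_0D[OF tc] lin_prod_0D[OF td] by blast+
  have e1: "DN \<zeta> / ?N \<zeta> = of_real A - of_real A\<^sub>0 / \<zeta>\<^sup>2 + deriv (lin_prod ta) \<zeta> / lin_prod ta \<zeta>
      - deriv (lin_prod tc) (1 / \<zeta>) / lin_prod tc (1 / \<zeta>) / \<zeta>\<^sup>2"
    using nz by (simp add: DN_def add_divide_distrib diff_divide_distrib)
  have e2: "DM \<zeta> / ?M \<zeta> = deriv (lin_prod td) (- 1 / \<zeta>) / lin_prod td (- 1 / \<zeta>) / \<zeta>\<^sup>2
      - deriv (lin_prod tb) (- \<zeta>) / lin_prod tb (- \<zeta>)"
    using nz by (simp add: DM_def add_divide_distrib diff_divide_distrib)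
  define \<eta> where "\<eta> = 1 / \<zeta>"
  have \<eta>: "1 / \<zeta> = \<eta>" "- 1 / \<zeta> = - \<eta>" by (simp_all add: \<eta>_def)
  have e3: "\<zeta> * (deriv ?N \<zeta> / ?N \<zeta> - deriv ?M \<zeta> / ?M \<zeta>)
      = of_real A * \<zeta> - of_real A\<^sub>0 * \<eta> + L ta \<zeta> - L tc \<eta> - L tb (- \<zeta>) + L td (- \<eta>)"
    unfolding DERIV_imp_deriv[OF dN[OF \<zeta>]] DERIV_imp_deriv[OF dM[OF \<zeta>]] e1 e2 L_def \<eta>_def
    using \<zeta> by (simp add: algebra_simps power2_eq_square)
  define r where "r = (norm \<zeta>)\<^sup>2"
  have r: "r > 0" using \<zeta> by (simp add: r_def)
  have inv: "Im \<zeta> = - (r * Im \<eta>)" using Im_inverse_sign[OF \<zeta>] by (simp add: r_def \<eta>_def)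
  \<comment> \<open>Trades \<open>Im \<zeta>\<close> for the imaginary part of \<eta> or
    \<open>- \<eta>\<close> at the cost of the positive factor \<open>r\<close>, so that the sign
    lemmas apply at these arguments.\<close>
  have flip: "- (y * Im \<zeta>) = r * (y * Im \<eta>)" "y * Im \<zeta> = r * (y * Im (- \<eta>))" for y
    unfolding inv by simp_all
  have eq: "Im (\<zeta> * (deriv ?N \<zeta> / ?N \<zeta> - deriv ?M \<zeta> / ?M \<zeta>)) * Im \<zeta>
      = A * (Im \<zeta> * Im \<zeta>) + A\<^sub>0 * (r * (Im \<eta> * Im \<eta>)) + Im (L ta \<zeta>) * Im \<zeta>
      + r * (Im (L tc \<eta>) * Im \<eta>) + Im (L tb (- \<zeta>)) * Im (- \<zeta>) + r * (Im (L td (- \<eta>)) * Im (- \<eta>))"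
    unfolding e3 flip[symmetric] by (simp add: algebra_simps)
  have Im\<eta>: "Im \<eta> \<noteq> 0" "Im (- \<eta>) \<noteq> 0" using inv Im by auto
  have nonneg: "0 \<le> Im (L t z) * Im z" if "\<And>n. t n \<ge> 0" "summable t" "Im z \<noteq> 0" for t z
    unfolding L_def using that by (rule lin_prod_logderiv_nonneg)
  have pos: "0 < Im (L t z) * Im z" if "\<And>n. t n \<ge> 0" "summable t" "Im z \<noteq> 0" "t n \<noteq> 0" for t z n
    unfolding L_def using that by (rule lin_prod_logderiv_pos)
  have "0 \<le> A * (Im \<zeta> * Im \<zeta>)" "0 \<le> A\<^sub>0 * (r * (Im \<eta> * Im \<eta>))"
    using A r by simp_all
  note nn = this nonneg[OF ta Im] nonneg[OF tb Im'(1)]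
    mult_nonneg_nonneg[OF less_imp_le[OF r] nonneg[OF tc Im\<eta>(1)]]
    mult_nonneg_nonneg[OF less_imp_le[OF r] nonneg[OF td Im\<eta>(2)]]
  have "0 < A * (Im \<zeta> * Im \<zeta>) \<or> 0 < A\<^sub>0 * (r * (Im \<eta> * Im \<eta>)) \<or> 0 < Im (L ta \<zeta>) * Im \<zeta>
      \<or> 0 < r * (Im (L tc \<eta>) * Im \<eta>) \<or> 0 < Im (L tb (- \<zeta>)) * Im (- \<zeta>)
      \<or> 0 < r * (Im (L td (- \<eta>)) * Im (- \<eta>))"
  proof -
    have "0 < Im \<zeta> * Im \<zeta>" "0 < r * (Im \<eta> * Im \<eta>)" using r Im Im\<eta> by (auto simp: zero_less_mult_iff)
    hence "0 < A * (Im \<zeta> * Im \<zeta>) \<or> A = 0" "0 < A\<^sub>0 * (r * (Im \<eta> * Im \<eta>)) \<or> A\<^sub>0 = 0"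
      using A mult_pos_pos by (metis less_le)+
    thus ?thesis
      using nontrivial pos[OF ta Im] pos[OF tb Im'(1)] mult_pos_pos[OF r pos[OF tc Im\<eta>(1)]]
        mult_pos_pos[OF r pos[OF td Im\<eta>(2)]] by blast
  qed
  thus "0 < Im (\<zeta> * (deriv ?N \<zeta> / ?N \<zeta> - deriv ?M \<zeta> / ?M \<zeta>)) * Im \<zeta>"
    unfolding eq by (elim disjE) (use nn in linarith)+
qed

section \<open>From the given products to weights\<close>

definition inv_weights :: "nat set \<Rightarrow> (nat \<Rightarrow> real) \<Rightarrow> nat \<Rightarrow> real" where
  "inv_weights I a = (\<lambda>n. if n \<in> I then 1 / a n else 0)"

lemma inv_weights_nonneg: "\<forall>n\<in>I. a n > 0 \<Longrightarrow> inv_weights I a n \<ge> 0"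
  by (auto simp: inv_weights_def less_imp_le)

lemma summable_inv_weights:
  assumes "abs_convergent_on I f" "\<And>n. n \<in> I \<Longrightarrow> norm (f n - 1) = 1 / a n"
  shows "summable (inv_weights I a)"
proof -
  have "(\<lambda>n. norm (factor_on I f n - 1)) = inv_weights I a"
    using assms(2) by (auto simp: factor_on_def inv_weights_def)
  thus ?thesis
    using assms(1) by (simp add: abs_convergent_on_def abs_convergent_prod_conv_summable)
qed

lemma prod_on_eq_lin_prod:
  assumes "\<And>n. n \<in> I \<Longrightarrow> f n = 1 + z / of_real (a n)"
  shows "prod_on I f = lin_prod (inv_weights I a) z"
proof -
  have "factor_on I f = (\<lambda>n. 1 + of_real (inv_weights I a n) * z)"
    using assms by (auto simp: factor_on_def inv_weights_def)
  thus ?thesis by (simp add: prod_on_def lin_prod_def)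
qed

theorem theorem19:
  fixes k :: nat and p :: int and A A\<^sub>0 :: real
    and Na Nb Nc Nd :: "nat set" and a b c d :: "nat \<Rightarrow> real"
    and \<alpha> :: complex
    and G :: "complex \<Rightarrow> complex" and D S :: "complex set"
  assumes "k \<ge> 2" and "gcd \<bar>p\<bar> (int k) = 1"
    and "A \<ge> 0" and "A\<^sub>0 \<ge> 0"
    and "\<forall>\<nu>\<in>Na. a \<nu> > 0" and "\<forall>\<mu>\<in>Nb. b \<mu> > 0"
    and "\<forall>\<nu>\<in>Nc. c \<nu> > 0" and "\<forall>\<mu>\<in>Nd. d \<mu> > 0"
    and "\<forall>z. z \<noteq> 0 \<longrightarrow> abs_convergent_on Na (\<lambda>\<nu>. 1 + z ^ k / of_real (a \<nu>))"
    and "\<forall>z. z \<noteq> 0 \<longrightarrow> abs_convergent_on Nb (\<lambda>\<mu>. 1 - z ^ k / of_real (b \<mu>))"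
    and "\<forall>z. z \<noteq> 0 \<longrightarrow> abs_convergent_on Nc (\<lambda>\<nu>. 1 + z powi (- int k) / of_real (c \<nu>))"
    and "\<forall>z. z \<noteq> 0 \<longrightarrow> abs_convergent_on Nd (\<lambda>\<mu>. 1 - z powi (- int k) / of_real (d \<mu>))"
    and "G = G_fun k p A A\<^sub>0 Na a Nb b Nc c Nd d"
    and "D = G_dom k Nb b Nd d"
    and "\<exists>z\<in>D. G z \<noteq> z powi p"
    and "Im (\<alpha> ^ k) \<noteq> 0"
    and "S = points_of G D \<alpha>"
  shows "(\<forall>z\<in>S. simple_point G z \<and> Im (z ^ k) \<noteq> 0 \<and> (\<forall>w\<in>S. norm w = norm z \<longrightarrow> w = z))
    \<and> (\<forall>z w (q::int) (m::int) (\<kappa>::int) (\<sigma>::int).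
         consecutive_in S z w \<and> \<kappa> \<in> {0, 1} \<and> \<sigma> \<in> {0, 1} \<and>
         \<alpha> \<in> Q_sector k (2 * q - \<kappa>) \<and> z \<in> Q_sector k (2 * m - \<sigma>) \<longrightarrow>
           (\<exists>l. [p * (l + m) = 2 * q + 1 - \<kappa> - \<sigma>] (mod int k)) \<and>
           (\<forall>l. [p * (l + m) = 2 * q + 1 - \<kappa> - \<sigma>] (mod int k) \<longrightarrow>
                w \<in> Q_sector k (2 * l - 1 + \<sigma>)))"
proof -
  have a: "inv_weights Na a n \<ge> 0" and b: "inv_weights Nb b n \<ge> 0"
    and c: "inv_weights Nc c n \<ge> 0" and d: "inv_weights Nd d n \<ge> 0" for n
    by (intro inv_weights_nonneg assms)+
  \<comment> \<open>The point \<open>z = 1\<close> is chosen because there the deviation of a factor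
    from 1 has the weight itself as norm.\<close>
  have sa: "summable (inv_weights Na a)"
    by (rule summable_inv_weights[OF assms(9)[rule_format, of 1]])
      (use assms(5) in \<open>auto simp: norm_divide\<close>)
  have sb: "summable (inv_weights Nb b)"
    by (rule summable_inv_weights[OF assms(10)[rule_format, of 1]])
      (use assms(6) in \<open>auto simp: norm_divide\<close>)
  have sc: "summable (inv_weights Nc c)"
    by (rule summable_inv_weights[OF assms(11)[rule_format, of 1]])
      (use assms(7) in \<open>auto simp: norm_divide\<close>)
  have sd: "summable (inv_weights Nd d)"
    by (rule summable_inv_weights[OF assms(12)[rule_format, of 1]])
      (use assms(8) in \<open>auto simp: norm_divide\<close>)
  define N where "N \<zeta> = exp (of_real A * \<zeta> + of_real A\<^sub>0 / \<zeta>)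
    * lin_prod (inv_weights Na a) \<zeta> * lin_prod (inv_weights Nc c) (1 / \<zeta>)" for \<zeta>
  define M where "M \<zeta> = lin_prod (inv_weights Nb b) (- \<zeta>) * lin_prod (inv_weights Nd d) (- 1 / \<zeta>)" for \<zeta>

  have G_eq: "G z = z powi p * (N (z ^ k) / M (z ^ k))" if "z \<noteq> 0" for z
  proof -
    have inv: "z powi (- int k) = 1 / z ^ k" by (simp add: power_int_minus field_simps)
    have "prod_on Na (\<lambda>\<nu>. 1 + z ^ k / of_real (a \<nu>)) = lin_prod (inv_weights Na a) (z ^ k)"
      "prod_on Nb (\<lambda>\<mu>. 1 - z ^ k / of_real (b \<mu>)) = lin_prod (inv_weights Nb b) (- (z ^ k))"
      "prod_on Nc (\<lambda>\<nu>. 1 + 1 / z ^ k / of_real (c \<nu>)) = lin_prod (inv_weights Nc c) (1 / z ^ k)"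
      "prod_on Nd (\<lambda>\<mu>. 1 - 1 / z ^ k / of_real (d \<mu>)) = lin_prod (inv_weights Nd d) (- 1 / z ^ k)"
      by (rule prod_on_eq_lin_prod; simp)+
    thus ?thesis by (simp add: assms(13) G_fun_def inv N_def M_def)
  qed

  interpret angular_quotient k p N M
    unfolding N_def M_def
  proof (rule angular_quotient_lin_prods)
    show "coprime p (int k)" using assms(2) by (simp add: coprime_iff_gcd_eq_1)
    \<comment> \<open>If everything vanished, \<open>N\<close> and \<open>M\<close> would be
      identically 1 and \<open>G z\<close> would be \<open>z powi p\<close> throughout
      \<open>D\<close>.\<close>
    show "A \<noteq> 0 \<or> A\<^sub>0 \<noteq> 0 \<or> (\<exists>n. inv_weights Na a n \<noteq> 0 \<or> inv_weights Nb b n \<noteq> 0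
        \<or> inv_weights Nc c n \<noteq> 0 \<or> inv_weights Nd d n \<noteq> 0)"
    proof (rule ccontr)
      assume trivial: "\<not> ?thesis"
      hence "inv_weights Na a = (\<lambda>_. 0)" "inv_weights Nb b = (\<lambda>_. 0)"
        "inv_weights Nc c = (\<lambda>_. 0)" "inv_weights Nd d = (\<lambda>_. 0)" by auto
      hence "N \<zeta> = 1" "M \<zeta> = 1" for \<zeta>
        using trivial by (simp_all add: N_def M_def lin_prod_def)
      thus False using assms(15) G_eq by (auto simp: assms(14) G_dom_def)
    qed
  qed (use assms a b c d sa sb sc sd in auto)

  have G_eq_g: "G z = g z" if "z \<noteq> 0" for z using G_eq[OF that] by (simp add: g_def)
  \<comment> \<open>Membership in \<open>D\<close> follows from the value: \<alpha> is nonzero as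
    \<open>\<alpha> ^ k\<close> is not real, while at a zero of \<open>M\<close> the quotient, and
    with it \<open>g z\<close>, is 0.\<close>
  have S_iff: "z \<in> S \<longleftrightarrow> g z = \<alpha>" for z
  proof
    assume "z \<in> S"
    thus "g z = \<alpha>" using G_eq_g[of z] by (auto simp: assms(14,17) points_of_def G_dom_def)
  next
    assume gz: "g z = \<alpha>"
    hence z: "z \<noteq> 0" "g z \<noteq> 0" using g_power_k_nonzero[of z] assms(16) by auto
    hence "M (z ^ k) \<noteq> 0" by (auto simp: g_def)
    hence nz: "1 + of_real (inv_weights Nb b n) * (- (z ^ k)) \<noteq> 0"
      "1 + of_real (inv_weights Nd d n) * (- 1 / z ^ k) \<noteq> 0" for n
      unfolding M_def using lin_prod_eq_0_iff[OF b sb] lin_prod_eq_0_iff[OF d sd] by auto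
    have "1 - z ^ k / of_real (b n) \<noteq> 0" if "n \<in> Nb" for n
      using nz(1)[of n] that by (simp add: inv_weights_def)
    moreover have "1 - z powi (- int k) / of_real (d n) \<noteq> 0" if "n \<in> Nd" for n
      using nz(2)[of n] that by (simp add: inv_weights_def power_int_minus field_simps)
    ultimately show "z \<in> S"
      using z gz G_eq_g[of z] by (auto simp: assms(14,17) points_of_def G_dom_def)
  qed
  have Im_g: "Im (g z ^ k) \<noteq> 0" if "z \<in> S" for z using that assms(16) S_iff by simp

  show ?thesis
  proof (intro conjI ballI allI impI)
    fix z assume z: "z \<in> S"
    \<comment> \<open>\<open>G\<close> and \<open>g\<close> are compared off 0 only, and
      \<open>z\<close> is nonzero, so they agree near \<open>z\<close>.\<close>
    have "eventually (\<lambda>w. w \<in> - {0}) (nhds z)"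
      using g_power_k_nonzero[OF Im_g[OF z]] by (intro eventually_nhds_in_open) auto
    hence "eventually (\<lambda>w. G w = g w) (nhds z)" by eventually_elim (simp add: G_eq_g)
    hence "deriv G z = deriv g z" by (rule deriv_cong_ev) simp
    thus "simple_point G z" using deriv_g_nonzero[OF Im_g[OF z]] by (simp add: simple_point_def)
    show "Im (z ^ k) \<noteq> 0" by (rule Im_power_k_nonzero[OF Im_g[OF z]])
    show "w = z" if "w \<in> S" "norm w = norm z" for w
      using eq_if_norm_eq[of w z] Im_g[OF that(1)] that z S_iff by simp
  next
    fix z w :: complex and q m \<kappa> \<sigma> :: int
    \<comment> \<open>\<open>x\<close> inverts \<open>p\<close> modulo \<open>k\<close>, so
      \<open>x * ?n - m\<close> solves the congruence.\<close>
    obtain x where x: "[p * x = 1] (mod int k)" using cong_solve_coprime_int[OF p_coprime] by blast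
    let ?n = "2 * q + 1 - \<kappa> - \<sigma>"
    have "[p * x * ?n = 1 * ?n] (mod int k)" using x by (rule cong_scalar_right)
    thus "\<exists>l. [p * (l + m) = ?n] (mod int k)"
      by (intro exI[of _ "x * ?n - m"]) (simp add: mult.assoc)
  next
    fix z w :: complex and q m \<kappa> \<sigma> l :: int
    assume *: "consecutive_in S z w \<and> \<kappa> \<in> {0, 1} \<and> \<sigma> \<in> {0, 1} \<and>
        \<alpha> \<in> Q_sector k (2 * q - \<kappa>) \<and> z \<in> Q_sector k (2 * m - \<sigma>)"
      and l: "[p * (l + m) = 2 * q + 1 - \<kappa> - \<sigma>] (mod int k)"
    have points: "g z = \<alpha>" "g w = \<alpha>" "norm z < norm w"
        "\<And>u. g u = \<alpha> \<Longrightarrow> norm z < norm u \<Longrightarrow> \<not> norm u < norm w"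
      using * by (auto simp: consecutive_in_def S_iff)
    \<comment> \<open>With \<open>n = 2 * q - \<kappa>\<close> the right side of the congruence is
      \<open>n + 1\<close> for \<sigma> = 0 and \<open>n\<close> for \<sigma> = 1, as the two cases
      require.\<close>
    from * consider "\<sigma> = 0" | "\<sigma> = 1" by auto
    thus "w \<in> Q_sector k (2 * l - 1 + \<sigma>)"
    proof cases
      case 1
      have "w \<in> Q_sector k (2 * l - 1)"
        by (rule consecutive_points_even_sector[OF assms(16), of "2 * q - \<kappa>" z m w l])
          (use * l points 1 in \<open>auto simp: algebra_simps\<close>)
      thus ?thesis by (simp add: 1)
    next
      case 2
      have "w \<in> Q_sector k (2 * l)"
        by (rule consecutive_points_odd_sector[OF assms(16), of "2 * q - \<kappa>" z m w l])
          (use * l points 2 in \<open>auto simp: algebra_simps\<close>)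
      thus ?thesis by (simp add: 2)
    qed
  qed
qed

end
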